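(* Let $w$ be a permutation. Then $$S_w=\sum_{\substack{\rho\in R(w)\\ \rho\ \text{super-standard}}}s_{\mathrm{Des}(\rho)}=\sum_\lambda c_{w,\lambda}\,s_\lambda,$$ where $S_w=\sum_{\rho\in R(w)}F_{\mathrm{Des}(\rho)}(X)$ is the Stanley symmetric function, the last sum is over partitions $\lambda$, and $c_{w,\lambda}$ is the number of super-standard reduced expressions $\rho\in R(w)$ with $\mathrm{Des}(\rho)=\lambda$.
   Context: Compositions. A weak composition is a finite sequence of nonnegative integers, a strong composition is a finite sequence of positive integers. For a weak composition $b$, $\mathrm{flat}(b)$ is the strong composition obtained by deleting zero parts. A strong composition $\beta$ refines $\alpha$ if there are indices $i_1<i_2<\cdots$ with $\beta_1+\cdots+\beta_{i_j}=\alpha_1+\cdots+\alpha_j$ for all $j$. The fundamental quasisymmetric function is $F_\alpha(X)=\sum x^b$, over weak compositions $b$ such that $\mathrm{flat}(b)$ refines $\alpha$, in the variables $X=\{x_1,x_2,\dots\}$. Schur functions. Partitions have Young diagrams in French notation (row $i$ from the bottom has $\lambda_i$ left-justified cells). $\mathrm{SYT}(\lambda)$ is the set of bijective fillings of the diagram of $\lambda$ with $1,\dots,N$ ($N=|\lambda|$) increasing along rows and up columns. $i$ is a descent of $T$ if $i+1$ lies weakly left of $i$; $\mathrm{Des}(T)$ is the strong composition of $N$ given by the lengths of the successive maximal runs of $1,2,\dots,N$ between descents. $s_\lambda(X)=\sum_{T\in\mathrm{SYT}(\lambda)}F_{\mathrm{Des}(T)}(X)$. The super-standard tableau $Y_\lambda\in\mathrm{SYT}(\lambda)$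 is the one whose entries, read right to left along the top row, then right to left along the next row down, and so on, form the word $N\cdots 21$. Reduced expressions. $R(w)$ is the set of reduced expressions $\rho=(\rho_k,\dots,\rho_1)$, $k=\mathrm{inv}(w)$, with $w=s_{\rho_k}\cdots s_{\rho_1}$, $s_i$ the simple transposition interchanging $i$ and $i+1$; the convention is that the one-line notation of $w$ is obtained from the identity by interchanging the entries in positions $\rho_1,\rho_1+1$, then those in positions $\rho_2,\rho_2+1$, and so on up to $\rho_k$ (for example $(4,2,1,2,3)\in R(42153)$). Letters are indexed from right to left. The run decomposition $\rho^{(r)}|\cdots|\rho^{(1)}$ of $\rho$ cuts the word, read left to right, into increasing sequences of maximal length, and $\mathrm{Des}(\rho)=(|\rho^{(1)}|,\dots,|\rho^{(r)}|)$. The maps $\mathfrak{d}_i$. For $\rho\in R(w)$ and $1<i<\mathrm{inv}(w)$: $\mathfrak{d}_i(\rho)=\mathfrak{b}_i(\rho)$ if $\rho_{i+1}=\rho_{i-1}=\rho_i\pm1$; $\mathfrak{d}_i(\rho)=\mathfrak{s}_{i-1}(\rho)$ if $\rho_{i-1}>\rho_{i+1}>\rho_i$ or $\rho_{i-1}<\rho_{i+1}<\rho_i$; $\mathfrak{d}_i(\rho)=\mathfrak{s}_i(\rho)$ if $\rho_{i+1}>\rho_{i-1}>\rho_i$ or $\rho_{i+1}<\rho_{i-1}<\rho_i$; $\mathfrak{d}_i(\rho)=\rho$ otherwise. Here $\mathfrak{s}_j$ interchanges the letters $\rho_j$ and $\rho_{j+1}$, and $\mathfrak{b}_j$ replaces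 the three letters in positions $j-1,j,j+1$, with values $x,y,x$, by $y,x,y$. Super-standard reduced expressions. Let $[\rho]$ be the equivalence class of $\rho$ in $R(w)$ generated by all $\mathfrak{d}_i$. The rectification map is a $\mathrm{Des}$-preserving map $\Phi:R(w)\to\bigcup_\lambda\mathrm{SYT}(\lambda)$ restricting on each class to a bijection with $\mathrm{SYT}(\lambda)$ for some $\lambda$; $\rho$ is super-standard if it rectifies to a super-standard tableau. That is, $\rho$ is super-standard if for some partition $\lambda$ there is a $\mathrm{Des}$-preserving bijection $[\rho]\to\mathrm{SYT}(\lambda)$ sending $\rho$ to $Y_\lambda$. *)

theory Defs
  imports
    "HOL-Combinatorics.Permutations"
    "HOL-Library.Poly_Mapping"
    "HOL-Library.Function_Algebras"
    "HOL-Library.FuncSet"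
begin

text \<open>
  The variables \<open>x\<^sub>1, x\<^sub>2, \<dots>\<close> are indexed here by \<open>0, 1, \<dots>\<close>. Weak compositions serve as
  exponent vectors, so they are taken up to trailing zeros, that is, as finitely supported
  functions. A formal power series of possibly infinitely many terms is its coefficient function;
  addition is pointwise.
\<close>

type_synonym weak_comp = "nat \<Rightarrow>\<^sub>0 nat"
type_synonym power_series = "weak_comp \<Rightarrow> int"

definition scale :: "int \<Rightarrow> power_series \<Rightarrow> power_series" where
  "scale c f = (\<lambda>b. c * f b)"

definition flat :: "weak_comp \<Rightarrow> nat list" where
  "flat b = map (Poly_Mapping.lookup b) (sorted_list_of_set (Poly_Mapping.keys b))"

text \<open>Refinement presupposes equal size, so that \<open>fund_qsym\<close> is homogeneous.\<close>

definition refines :: "nat list \<Rightarrow> nat list \<Rightarrow> bool" where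
  "refines \<beta> \<alpha> \<longleftrightarrow>
     sum_list \<beta> = sum_list \<alpha> \<and>
     (\<exists>idx :: nat \<Rightarrow> nat.
        strict_mono_on {1..length \<alpha>} idx \<and>
        (\<forall>j\<in>{1..length \<alpha>}. idx j \<in> {1..length \<beta>} \<and>
           sum_list (take (idx j) \<beta>) = sum_list (take j \<alpha>)))"

definition fund_qsym :: "nat list \<Rightarrow> power_series" where
  "fund_qsym \<alpha> = (\<lambda>b. if refines (flat b) \<alpha> then 1 else 0)"

text \<open>
  Cut a list, read left to right, into the longest possible blocks in which each pair of
  neighbours satisfies \<open>P\<close>.
\<close>

fun runs_by :: "('a \<Rightarrow> 'a \<Rightarrow> bool) \<Rightarrow> 'a list \<Rightarrow> 'a list list" where
  "runs_by P [] = []"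
| "runs_by P [x] = [[x]]"
| "runs_by P (x # y # zs) =
     (let rs = runs_by P (y # zs)
      in if P x y then (x # hd rs) # tl rs else [x] # rs)"

definition is_partition :: "nat list \<Rightarrow> bool" where
  "is_partition lam \<longleftrightarrow> sorted_wrt (\<ge>) lam \<and> 0 \<notin> set lam"

text \<open>
  Cells are pairs (row, column), both counted from \<open>0\<close>; row \<open>0\<close> is the bottom row (French
  notation). A filling is \<open>undefined\<close> outside of the diagram, so that distinct functions are
  distinct fillings.
\<close>

definition diagram :: "nat list \<Rightarrow> (nat \<times> nat) set" where
  "diagram lam = {(r, c). r < length lam \<and> c < lam ! r}"

type_synonym filling = "nat \<times> nat \<Rightarrow> nat"

definition SYT :: "nat list \<Rightarrow> filling set" where
  "SYT lam = {T \<in> extensional (diagram lam).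
     bij_betw T (diagram lam) {1..sum_list lam} \<and>
     (\<forall>r c c'. (r, c) \<in> diagram lam \<and> (r, c') \<in> diagram lam \<and> c < c' \<longrightarrow> T (r, c) < T (r, c')) \<and>
     (\<forall>r r' c. (r, c) \<in> diagram lam \<and> (r', c) \<in> diagram lam \<and> r < r' \<longrightarrow> T (r, c) < T (r', c))}"

definition tab_column :: "nat list \<Rightarrow> filling \<Rightarrow> nat \<Rightarrow> nat" where
  "tab_column lam T i = snd (inv_into (diagram lam) T i)"

text \<open>\<open>i\<close> is a descent of \<open>T\<close> if and only if \<open>tab_column lam T (i + 1) \<le> tab_column lam T i\<close>.\<close>

definition tab_Des :: "nat list \<Rightarrow> filling \<Rightarrow> nat list" where
  "tab_Des lam T =
     map length (runs_by (\<lambda>i i'. \<not> tab_column lam T i' \<le> tab_column lam T i) [1..<Suc (sum_list lam)])"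

definition schur :: "nat list \<Rightarrow> power_series" where
  "schur lam = (\<Sum>T\<in>SYT lam. fund_qsym (tab_Des lam T))"

definition rev_reading_word :: "nat list \<Rightarrow> filling \<Rightarrow> nat list" where
  "rev_reading_word lam T =
     concat (map (\<lambda>r. map (\<lambda>c. T (r, c)) (rev [0..<lam ! r])) (rev [0..<length lam]))"

definition super_tableau :: "nat list \<Rightarrow> filling" where
  "super_tableau lam =
     (THE T. T \<in> SYT lam \<and> rev_reading_word lam T = rev [1..<Suc (sum_list lam)])"

text \<open>A word \<open>(\<rho>\<^sub>k, \<dots>, \<rho>\<^sub>1)\<close> is stored as the list \<open>[\<rho>\<^sub>k, \<dots>, \<rho>\<^sub>1]\<close>.\<close>

definition letter :: "nat list \<Rightarrow> nat \<Rightarrow> nat" where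
  "letter \<rho> j = \<rho> ! (length \<rho> - j)"

definition set_letter :: "nat \<Rightarrow> nat \<Rightarrow> nat list \<Rightarrow> nat list" where
  "set_letter j a \<rho> = \<rho>[length \<rho> - j := a]"

text \<open>
  A permutation \<open>u\<close> has one-line notation \<open>u 1, u 2, \<dots>\<close>, and passing from \<open>u\<close> to
  \<open>u \<circ> transpose i (i + 1)\<close> interchanges the entries in positions \<open>i\<close> and \<open>i + 1\<close>. The letters
  act on positions in the order \<open>\<rho>\<^sub>1, \<dots>, \<rho>\<^sub>k\<close>, starting from the identity.
\<close>

definition word_perm :: "nat list \<Rightarrow> nat \<Rightarrow> nat" where
  "word_perm \<rho> = foldr (\<lambda>i u. u \<circ> transpose i (Suc i)) \<rho> id"

definition inversion_number :: "nat \<Rightarrow> (nat \<Rightarrow> nat) \<Rightarrow> nat" where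
  "inversion_number n w = card {(i, j). 1 \<le> i \<and> i < j \<and> j \<le> n \<and> w j < w i}"

text \<open>For a permutation \<open>w\<close> of \<open>{1..n}\<close>, with the simple transpositions \<open>s\<^sub>1, \<dots>, s\<^sub>n\<^sub>-\<^sub>1\<close>.\<close>

definition reduced_exprs :: "nat \<Rightarrow> (nat \<Rightarrow> nat) \<Rightarrow> nat list set" where
  "reduced_exprs n w =
     {\<rho>. set \<rho> \<subseteq> {1..<n} \<and> length \<rho> = inversion_number n w \<and> word_perm \<rho> = w}"

definition word_Des :: "nat list \<Rightarrow> nat list" where
  "word_Des \<rho> = map length (rev (runs_by (<) \<rho>))"

definition stanley :: "nat \<Rightarrow> (nat \<Rightarrow> nat) \<Rightarrow> power_series" where
  "stanley n w = (\<Sum>\<rho>\<in>reduced_exprs n w. fund_qsym (word_Des \<rho>))"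

definition swap_letters :: "nat \<Rightarrow> nat list \<Rightarrow> nat list" where
  "swap_letters j \<rho> =
     set_letter j (letter \<rho> (j + 1)) (set_letter (j + 1) (letter \<rho> j) \<rho>)"

definition braid_letters :: "nat \<Rightarrow> nat list \<Rightarrow> nat list" where
  "braid_letters j \<rho> =
     (let x = letter \<rho> (j - 1); y = letter \<rho> j
      in set_letter (j - 1) y (set_letter j x (set_letter (j + 1) y \<rho>)))"

definition dual_equiv :: "nat \<Rightarrow> nat list \<Rightarrow> nat list" where
  "dual_equiv i \<rho> =
     (let a = letter \<rho> (i + 1); b = letter \<rho> i; c = letter \<rho> (i - 1)
      in if a = c \<and> (c = b + 1 \<or> b = c + 1) then braid_letters i \<rho>
         else if (c > a \<and> a > b) \<or> (c < a \<and> a < b) then swap_letters (i - 1) \<rho>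
         else if (a > c \<and> c > b) \<or> (a < c \<and> c < b) then swap_letters i \<rho>
         else \<rho>)"

definition dual_step :: "nat \<Rightarrow> (nat \<Rightarrow> nat) \<Rightarrow> nat list \<Rightarrow> nat list \<Rightarrow> bool" where
  "dual_step n w \<rho> \<sigma> \<longleftrightarrow>
     \<rho> \<in> reduced_exprs n w \<and> (\<exists>i. 1 < i \<and> i < inversion_number n w \<and> \<sigma> = dual_equiv i \<rho>)"

definition dual_class :: "nat \<Rightarrow> (nat \<Rightarrow> nat) \<Rightarrow> nat list \<Rightarrow> nat list set" where
  "dual_class n w \<rho> = {\<sigma> \<in> reduced_exprs n w. equivclp (dual_step n w) \<rho> \<sigma>}"

definition super_standard :: "nat \<Rightarrow> (nat \<Rightarrow> nat) \<Rightarrow> nat list \<Rightarrow> bool" where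
  "super_standard n w \<rho> \<longleftrightarrow>
     \<rho> \<in> reduced_exprs n w \<and>
     (\<exists>lam f. is_partition lam \<and>
        bij_betw f (dual_class n w \<rho>) (SYT lam) \<and>
        (\<forall>\<sigma>\<in>dual_class n w \<rho>. tab_Des lam (f \<sigma>) = word_Des \<sigma>) \<and>
        f \<rho> = super_tableau lam)"

definition super_count :: "nat \<Rightarrow> (nat \<Rightarrow> nat) \<Rightarrow> nat list \<Rightarrow> nat" where
  "super_count n w lam =
     card {\<rho> \<in> reduced_exprs n w. super_standard n w \<rho> \<and> word_Des \<rho> = lam}"

lemma finite_diagram: "finite (diagram lam)"
proof -
  have "diagram lam = (SIGMA r:{..<length lam}. {..<lam ! r})"
    by (auto simp: diagram_def)
  then show ?thesis by simp
qed

lemma finite_SYT: "finite (SYT lam)"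
proof (rule finite_subset)
  show "SYT lam \<subseteq> diagram lam \<rightarrow>\<^sub>E {1..sum_list lam}"
    unfolding SYT_def PiE_def Pi_def by (auto dest: bij_betwE)
  show "finite (diagram lam \<rightarrow>\<^sub>E {1..sum_list lam})"
    by (intro finite_PiE finite_diagram) simp
qed

lemma finite_reduced_exprs: "finite (reduced_exprs n w)"
  by (rule finite_subset[OF _ finite_lists_length_eq[of "{1..<n}" "inversion_number n w"]])
     (auto simp: reduced_exprs_def)

lemma finite_super_support: "finite {lam. is_partition lam \<and> super_count n w lam \<noteq> 0}"
proof (rule finite_subset)
  show "{lam. is_partition lam \<and> super_count n w lam \<noteq> 0} \<subseteq> word_Des ` reduced_exprs n w"
  proof
    fix lam assume "lam \<in> {lam. is_partition lam \<and> super_count n w lam \<noteq> 0}"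
    then have "super_count n w lam \<noteq> 0" by simp
    then have "{\<rho> \<in> reduced_exprs n w. super_standard n w \<rho> \<and> word_Des \<rho> = lam} \<noteq> {}"
      unfolding super_count_def by (metis card.empty)
    then show "lam \<in> word_Des ` reduced_exprs n w" by blast
  qed
qed (simp add: finite_reduced_exprs)

lemma rev_reading_word_rev:
  "rev (rev_reading_word lam T) = concat (map (\<lambda>r. map (\<lambda>c. T (r, c)) [0..<lam ! r]) [0..<length lam])"
  by (simp add: rev_reading_word_def rev_concat rev_map o_def flip: rev_map)

lemma rev_reading_word_inject:
  assumes "T \<in> extensional (diagram lam)" "T' \<in> extensional (diagram lam)"
    and "rev_reading_word lam T = rev_reading_word lam T'"
  shows "T = T'"
proof (rule extensionalityI[OF assms(1,2)])
  fix x assume x: "x \<in> diagram lam"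
  obtain r c where rc: "x = (r, c)" "r < length lam" "c < lam ! r"
    using x by (auto simp: diagram_def)
  let ?m = "\<lambda>T. map (\<lambda>r. map (\<lambda>c. T (r, c)) [0..<lam ! r]) [0..<length lam]"
  have "concat (?m T) = concat (?m T')"
    using assms(3) by (metis rev_reading_word_rev)
  then have "?m T = ?m T'"
    by (rule concat_injective) (auto simp: zip_map_map set_zip)
  then have "?m T ! r ! c = ?m T' ! r ! c" by (rule arg_cong[where f = "\<lambda>m. m ! r ! c"])
  then show "T x = T' x" using rc by simp
qed

lemma sum_list_take_mono: "r \<le> r' \<Longrightarrow> sum_list (take r xs) \<le> sum_list (take r' (xs :: nat list))"
  by (metis le_add1 le_add_diff_inverse sum_list_append take_add)

lemma ex1_super_tableau:
  assumes "is_partition lam"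
  shows "\<exists>!T. T \<in> SYT lam \<and> rev_reading_word lam T = rev [1..<Suc (sum_list lam)]"
proof -
  define T where "T = restrict (\<lambda>(r, c). sum_list (take r lam) + c + 1) (diagram lam)"
  have T: "T (r, c) = sum_list (take r lam) + c + 1" if "r < length lam" "c < lam ! r" for r c
    using that by (simp add: T_def diagram_def)
  have w: "concat (map (\<lambda>r. map (\<lambda>c. T (r, c)) [0..<lam ! r]) [0..<m])
      = [1..<Suc (sum_list (take m lam))]" if "m \<le> length lam" for m
    using that
  proof (induction m)
    case (Suc m)
    have "map (\<lambda>c. T (m, c)) [0..<lam ! m]
        = [Suc (sum_list (take m lam))..<Suc (sum_list (take m lam)) + lam ! m]"
      by (rule nth_equalityI) (use Suc.prems in \<open>simp_all add: T del: upt_Suc\<close>)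
    moreover have "sum_list (take (Suc m) lam) = sum_list (take m lam) + lam ! m"
      using Suc.prems by (simp add: take_Suc_conv_app_nth)
    moreover have "[1..<Suc (sum_list (take m lam) + lam ! m)] = [1..<Suc (sum_list (take m lam))]
        @ [Suc (sum_list (take m lam))..<Suc (sum_list (take m lam)) + lam ! m]"
      using upt_add_eq_append[of 1 "Suc (sum_list (take m lam))" "lam ! m"] by simp
    ultimately show ?case using Suc by simp
  qed simp
  have word: "rev (rev_reading_word lam T) = [1..<Suc (sum_list lam)]"
    using w[of "length lam"] by (simp add: rev_reading_word_rev)
  have less: "T (r, c) < T (r', c')" if "r < r'" "r' < length lam" "c < lam ! r" "c' < lam ! r'" for r r' c c'
  proof -
    have "sum_list (take r lam) + lam ! r = sum_list (take (Suc r) lam)"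
      using that by (simp add: take_Suc_conv_app_nth)
    also have "\<dots> \<le> sum_list (take r' lam)" using that by (intro sum_list_take_mono) simp
    finally show ?thesis using that by (simp add: T)
  qed
  have inj: "inj_on T (diagram lam)"
  proof (rule inj_onI, clarify)
    fix r c r' c'
    assume "(r, c) \<in> diagram lam" "(r', c') \<in> diagram lam" and eq: "T (r, c) = T (r', c')"
    then have d: "r < length lam" "c < lam ! r" "r' < length lam" "c' < lam ! r'"
      by (auto simp: diagram_def)
    then have "r = r'" using less[of r r' c c'] less[of r' r c' c] eq by (metis less_irrefl nat_neq_iff)
    then show "r = r' \<and> c = c'" using d eq by (simp add: T)
  qed
  have "T ` diagram lam = set (rev (rev_reading_word lam T))"
    by (force simp: rev_reading_word_rev diagram_def)
  then have "T ` diagram lam = {1..sum_list lam}" unfolding word by auto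
  then have "bij_betw T (diagram lam) {1..sum_list lam}" using inj by (simp add: bij_betw_def)
  moreover have "T \<in> extensional (diagram lam)" by (simp add: T_def)
  ultimately have "T \<in> SYT lam"
    unfolding SYT_def by (auto simp: diagram_def intro: less) (simp add: T)
  then show ?thesis
    using word rev_reading_word_inject by (intro ex1I[of _ T]) (auto simp: SYT_def rev_swap)
qed

end

theory Submission
  imports Defs
begin

text \<open>
  The classes generated by the maps \<open>dual_equiv i\<close> are the Coxeter--Knuth classes.
  Edelman--Greene insertion, applied to the letters \<open>\<rho>\<^sub>1, \<rho>\<^sub>2, \<dots>\<close> in turn and bumping from
  column to column, gives an insertion tableau, which distinguishes exactly these classes, and
  a recording tableau. Insertion being reversible, every class is in bijection with the standard
  tableaux of one shape. Bumping preserves the order of consecutive letters, so the bijection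
  preserves descents, and summing fundamental quasisymmetric functions over a class gives a
  Schur function. If a tableau of shape \<open>\<lambda>\<close> has descent composition \<open>\<mu>\<close>, then \<open>\<mu>\<close> is dominated
  by \<open>\<lambda>\<close>, with equality only for the super-standard tableau; hence every class has exactly one
  super-standard element, and its descent composition is the shape.
\<close>

section \<open>Reduced words and Coxeter--Knuth moves\<close>

text \<open>Insertion and its reversal behave well on reduced words only. Reducedness is therefore
  defined by minimal length, which passes at once to factors and along moves, and it is exploited
  through one fact: no letter occurs twice with only commuting letters in between. This yields
  \<open>ok\<close> and its mirror image, the side conditions that make each bump well defined and
  reversible.

  Invariance of the insertion tableau is local. A move fed into a column leaves the same column
  behind and sends to the next one either the same word or one related by a move, possibly of
  another kind; hence the three relations must be treated together.

  No recording tableau is built. The recording is the word of columns in which new cells appear.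
  These words and the column words of standard tableaux fill the same set of lattice words of given
  content, and on both sides descents are comparisons of neighbouring letters.

  \<open>super_standard\<close> admits any shape and any descent-preserving bijection, not just the
  one given by insertion; dominance in both directions removes this freedom.\<close>

definition reduced :: "nat list \<Rightarrow> bool" where
  "reduced \<rho> \<longleftrightarrow> (\<forall>\<sigma>. word_perm \<sigma> = word_perm \<rho> \<longrightarrow> length \<rho> \<le> length \<sigma>)"

lemma word_perm_Nil [simp]: "word_perm [] = id"
  by (simp add: word_perm_def)

lemma word_perm_Cons [simp]: "word_perm (x # \<rho>) = word_perm \<rho> \<circ> transpose x (Suc x)"
  by (simp add: word_perm_def)

lemma word_perm_append [simp]: "word_perm (u @ v) = word_perm v \<circ> word_perm u"
  by (induction u) (simp_all add: o_assoc)

lemma reduced_middle: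
  assumes "reduced (u @ s @ v)"
  shows "reduced s"
  unfolding reduced_def
proof (intro allI impI)
  fix t assume "word_perm t = word_perm s"
  then have "length (u @ s @ v) \<le> length (u @ t @ v)"
    using assms unfolding reduced_def by (metis word_perm_append)
  then show "length s \<le> length t" by simp
qed

lemma reduced_prefix: "reduced (s @ v) \<Longrightarrow> reduced s"
  using reduced_middle[of "[]"] by simp

lemma reduced_suffix: "reduced (u @ s) \<Longrightarrow> reduced s"
  using reduced_middle[of u s "[]"] by simp

lemma reduced_cong: "word_perm s = word_perm t \<Longrightarrow> length s = length t \<Longrightarrow> reduced s \<longleftrightarrow> reduced t"
  by (simp add: reduced_def)

lemma transpose_simple_commute:
  assumes "Suc x < y"
  shows "transpose x (Suc x) \<circ> transpose y (Suc y) = transpose y (Suc y) \<circ> transpose x (Suc x)"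
  using assms by (auto simp: fun_eq_iff transpose_def)

lemma word_perm_commute:
  assumes "\<forall>m\<in>set ms. Suc x < m \<or> Suc m < x"
  shows "word_perm ms \<circ> transpose x (Suc x) = transpose x (Suc x) \<circ> word_perm ms"
  using assms
proof (induction ms)
  case (Cons m ms)
  have "transpose m (Suc m) \<circ> transpose x (Suc x) = transpose x (Suc x) \<circ> transpose m (Suc m)"
    using Cons.prems transpose_simple_commute[of x m] transpose_simple_commute[of m x] by auto
  then have "word_perm (m # ms) \<circ> transpose x (Suc x)
      = (word_perm ms \<circ> transpose x (Suc x)) \<circ> transpose m (Suc m)"
    by (simp only: word_perm_Cons comp_assoc)
  also have "word_perm ms \<circ> transpose x (Suc x) = transpose x (Suc x) \<circ> word_perm ms"
    by (rule Cons.IH) (use Cons.prems in simp)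
  finally show ?case by (simp only: word_perm_Cons comp_assoc)
qed simp

text \<open>Moving one \<open>x\<close> through \<open>ms\<close> lets the two equal transpositions
  cancel, so a word with two letters fewer has the same permutation.\<close>

lemma not_reduced_commuting:
  assumes "\<forall>m\<in>set ms. Suc x < m \<or> Suc m < x"
  shows "\<not> reduced (u @ x # ms @ x # v)"
proof
  assume "reduced (u @ x # ms @ x # v)"
  then have "reduced (x # ms @ [x])" using reduced_middle[of u "x # ms @ [x]" v] by simp
  moreover have "word_perm (x # ms @ [x]) = word_perm ms"
    using word_perm_commute[OF assms] by (simp add: comp_assoc) (simp add: o_assoc)
  ultimately show False unfolding reduced_def by fastforce
qed

section \<open>Inversions as a lower bound for word length\<close>

definition inversions :: "(nat \<Rightarrow> nat) \<Rightarrow> (nat \<times> nat) set" where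
  "inversions u = {(i, j). i < j \<and> u j < u i}"

text \<open>Only the positions \<open>i\<close> and \<open>Suc i\<close> change their relative
  order; every other inversion is merely relabelled. So one letter adds at most one
  inversion.\<close>

lemma inversions_transpose:
  "inversions (u \<circ> transpose i (Suc i)) \<subseteq>
     insert (i, Suc i) (map_prod (transpose i (Suc i)) (transpose i (Suc i)) ` inversions u)"
proof (rule subsetI, clarify)
  fix a b let ?t = "transpose i (Suc i)"
  assume ab: "(a, b) \<in> inversions (u \<circ> ?t)"
    "(a, b) \<notin> map_prod ?t ?t ` inversions u"
  then have "a < b" "u (?t b) < u (?t a)" by (auto simp: inversions_def)
  have "(?t a, ?t b) \<notin> inversions u"
  proof
    assume "(?t a, ?t b) \<in> inversions u"
    then have "map_prod ?t ?t (?t a, ?t b) \<in> map_prod ?t ?t ` inversions u" by (rule imageI)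
    then show False using ab by simp
  qed
  then have "\<not> ?t a < ?t b" using \<open>u (?t b) < u (?t a)\<close> by (auto simp: inversions_def)
  then show "a = i \<and> b = Suc i"
    using \<open>a < b\<close> by (auto simp: transpose_def split: if_splits)
qed

lemma inversions_word_perm:
  "finite (inversions (word_perm \<rho>)) \<and> card (inversions (word_perm \<rho>)) \<le> length \<rho>"
proof (induction \<rho>)
  case Nil
  have "inversions id = {}" by (auto simp: inversions_def)
  then show ?case by (simp del: id_apply add: id_def[symmetric])
next
  case (Cons x \<rho>)
  let ?t = "transpose x (Suc x)"
  have sub: "inversions (word_perm (x # \<rho>))
      \<subseteq> insert (x, Suc x) (map_prod ?t ?t ` inversions (word_perm \<rho>))" (is "_ \<subseteq> ?B")
    using inversions_transpose by simp
  have fin: "finite ?B" using Cons by simp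
  have "card ?B \<le> Suc (card (inversions (word_perm \<rho>)))"
    using Cons card_image_le[of "inversions (word_perm \<rho>)" "map_prod ?t ?t"]
    by (simp add: card_insert_if del: word_perm_Cons)
  then show ?case
    using Cons finite_subset[OF sub fin] card_mono[OF fin sub] by (simp del: word_perm_Cons)
qed

text \<open>Points outside \<open>{1..n}\<close> are fixed and take part in no inversion, so
  counting over all pairs of naturals gives the same number.\<close>

lemma inversion_number_eq:
  assumes "w permutes {1..n}"
  shows "inversion_number n w = card (inversions w)"
proof -
  have "1 \<le> i \<and> j \<le> n" if "i < j" "w j < w i" for i j
  proof -
    have out: "w k = k" if "k \<notin> {1..n}" for k using assms that by (rule permutes_not_in)
    have "i \<noteq> 0" using that out[of 0] by (intro notI) simp
    moreover have "j \<le> n"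
    proof (rule ccontr)
      assume "\<not> j \<le> n"
      then have "w j = j" using out by simp
      then have "w i \<notin> {1..n}" "i \<noteq> w i" using that \<open>\<not> j \<le> n\<close> by auto
      then show False using out[of i] permutes_in_image[OF assms] by metis
    qed
    ultimately show ?thesis by simp
  qed
  then have "inversions w = {(i, j). 1 \<le> i \<and> i < j \<and> j \<le> n \<and> w j < w i}"
    unfolding inversions_def by auto
  then show ?thesis by (simp add: inversion_number_def)
qed

text \<open>Any word for \<open>w\<close> needs at least as many letters as \<open>w\<close> has
  inversions, and these words attain the bound.\<close>

lemma reduced_exprs_reduced:
  assumes "w permutes {1..n}" "\<rho> \<in> reduced_exprs n w"
  shows "reduced \<rho>"
  using assms inversions_word_perm inversion_number_eq[OF assms(1)]
  unfolding reduced_def reduced_exprs_def by (metis (mono_tags, lifting) mem_Collect_eq)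

text \<open>The elementary Coxeter-Knuth relations, each in one orientation; \<open>ck_equiv\<close>
  adds the other. In the first two (called inner and outer below), \<open>y\<close> is an unmoved
  witness strictly between the two letters exchanged, which therefore commute.\<close>

inductive ck_move :: "nat list \<Rightarrow> nat list \<Rightarrow> bool" where
  "x < y \<Longrightarrow> y < z \<Longrightarrow> ck_move [y, x, z] [y, z, x]"
| "x < y \<Longrightarrow> y < z \<Longrightarrow> ck_move [x, z, y] [z, x, y]"
| "ck_move [x, Suc x, x] [Suc x, x, Suc x]"

definition ck_step :: "nat list \<Rightarrow> nat list \<Rightarrow> bool" where
  "ck_step \<rho> \<sigma> \<longleftrightarrow> (\<exists>u v s t. ck_move s t \<and> \<rho> = u @ s @ v \<and> \<sigma> = u @ t @ v)"

abbreviation ck_equiv :: "nat list \<Rightarrow> nat list \<Rightarrow> bool" where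
  "ck_equiv \<equiv> equivclp ck_step"

lemma ck_move_facts:
  assumes "ck_move s t"
  shows "word_perm s = word_perm t" "length s = length t" "set s = set t" "length s = 3"
proof -
  show "word_perm s = word_perm t"
    using assms
  proof cases
    case (1 x y z)
    then show ?thesis using transpose_simple_commute[of x z] by (simp add: o_assoc)
  next
    case (2 x y z)
    then show ?thesis using transpose_simple_commute[of x z] by (simp add: comp_assoc)
  next
    case (3 x)
    then show ?thesis by (simp add: fun_eq_iff transpose_def)
  qed
qed (use assms in \<open>cases; auto\<close>)+

lemma ck_equiv_facts:
  assumes "ck_equiv \<rho> \<sigma>"
  shows "word_perm \<rho> = word_perm \<sigma> \<and> length \<rho> = length \<sigma> \<and> set \<rho> = set \<sigma>"
  using assms
proof (induction rule: equivclp_induct)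
  case (step y z)
  from step(2) obtain u v s t where *: "ck_move s t" "{y, z} = {u @ s @ v, u @ t @ v}"
    unfolding ck_step_def by blast
  then show ?case using step(3) ck_move_facts[OF *(1)] by (auto simp: doubleton_eq_iff)
qed simp

lemma ck_equiv_reduced: "ck_equiv \<rho> \<sigma> \<Longrightarrow> reduced \<rho> \<longleftrightarrow> reduced \<sigma>"
  using ck_equiv_facts reduced_cong by blast

lemma ck_equiv_trans [trans]: "ck_equiv a b \<Longrightarrow> ck_equiv b c \<Longrightarrow> ck_equiv a c"
  by (rule equivclp_trans)

lemma ck_equiv_context:
  assumes "ck_equiv \<rho> \<sigma>"
  shows "ck_equiv (u @ \<rho> @ v) (u @ \<sigma> @ v)"
  using assms
proof (induction rule: equivclp_induct)
  case (step y z)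
  have *: "ck_step (u @ a @ v) (u @ b @ v)" if "ck_step a b" for a b
    using that unfolding ck_step_def by (metis append.assoc)
  then show ?case using step by (meson equivclp_into_equivclp)
qed simp

lemma ck_move_equiv: "ck_move s t \<Longrightarrow> ck_equiv (u @ s @ v) (u @ t @ v)"
  unfolding ck_step_def by (intro r_into_equivclp) blast

text \<open>Letters are indexed from the right, so with \<open>v\<close> behind the window the
  middle letter \<open>b\<close> has index \<open>length v + 2\<close>.\<close>

lemma dual_equiv_append:
  "dual_equiv (length v + 2) (u @ [a, b, c] @ v) =
     u @ (if a = c \<and> (c = b + 1 \<or> b = c + 1) then [b, a, b]
          else if (c > a \<and> a > b) \<or> (c < a \<and> a < b) then [a, c, b]
          else if (a > c \<and> c > b) \<or> (a < c \<and> c < b) then [b, a, c]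
          else [a, b, c]) @ v"
proof -
  have len: "Suc (length u + 2 + length v) - Suc (length v) = length u + 2"
    by simp
  show ?thesis
    by (simp add: dual_equiv_def letter_def braid_letters_def swap_letters_def set_letter_def
        nth_append list_update_append Let_def numeral_2_eq_2 numeral_3_eq_3 del: One_nat_def) auto
qed

lemma dual_equiv_ck:
  assumes "1 < i" "i < length \<rho>"
  shows "ck_equiv \<rho> (dual_equiv i \<rho>)"
proof -
  define k where "k = length \<rho> - i - 1"
  have k: "k + 2 < length \<rho>" using assms by (simp add: k_def)
  define u v where "u = take k \<rho>" and "v = drop (k + 3) \<rho>"
  have \<rho>: "\<rho> = u @ [\<rho> ! k, \<rho> ! (k + 1), \<rho> ! (k + 2)] @ v"
    using k id_take_nth_drop[of k \<rho>] Cons_nth_drop_Suc[of "k + 1" \<rho>] Cons_nth_drop_Suc[of "k + 2" \<rho>]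
    by (simp add: u_def v_def eval_nat_numeral)
  have i: "i = length v + 2" using assms by (simp add: v_def k_def)
  obtain a b c where abc: "\<rho> = u @ [a, b, c] @ v" using \<rho> by blast
  define t where "t = (if a = c \<and> (c = b + 1 \<or> b = c + 1) then [b, a, b]
          else if (c > a \<and> a > b) \<or> (c < a \<and> a < b) then [a, c, b]
          else if (a > c \<and> c > b) \<or> (a < c \<and> c < b) then [b, a, c]
          else [a, b, c])"
  have ck: "ck_move [a, b, c] t \<or> ck_move t [a, b, c] \<or> t = [a, b, c]"
  proof (cases "a = c \<and> (c = b + 1 \<or> b = c + 1)")
    case True
    then show ?thesis using ck_move.intros(3)[of b] ck_move.intros(3)[of c] by (auto simp: t_def)
  next
    case False
    \<comment> \<open>If \<open>a\<close> or \<open>c\<close> has the middle value, it is the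
      witness for exchanging the other two letters; in all remaining cases \<open>t\<close> is the
      window itself.\<close>
    consider "b < a \<and> a < c" | "c < a \<and> a < b" | "b < c \<and> c < a" | "a < c \<and> c < b"
      | "\<not> (c > a \<and> a > b \<or> c < a \<and> a < b)" "\<not> (a > c \<and> c > b \<or> a < c \<and> c < b)"
      by blast
    then show ?thesis by cases (use False in \<open>auto simp: t_def intro: ck_move.intros(1,2)\<close>)
  qed
  have "dual_equiv i \<rho> = u @ t @ v" unfolding abc i dual_equiv_append t_def ..
  then show ?thesis using ck ck_move_equiv[of "[a, b, c]" t u v] ck_move_equiv[of t "[a, b, c]" u v]
    unfolding abc by (auto intro: equivclp_sym simp del: append.simps)
qed

lemma ck_move_dual_equiv:
  assumes "ck_move s t"
  shows "dual_equiv (length v + 2) (u @ s @ v) = u @ t @ v"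
    "dual_equiv (length v + 2) (u @ t @ v) = u @ s @ v"
  using assms by (cases; simp only: dual_equiv_append; simp)+

lemma reduced_exprs_ck:
  assumes "\<rho> \<in> reduced_exprs n w" "ck_equiv \<rho> \<sigma>"
  shows "\<sigma> \<in> reduced_exprs n w"
  using assms ck_equiv_facts[OF assms(2)] by (simp add: reduced_exprs_def)

text \<open>Each move and its inverse is some \<open>dual_equiv i\<close>, and each admissible
  \<open>dual_equiv i\<close> is a move, an inverse move or the identity. Moves keep permutation,
  length and letter set, so they never leave \<open>reduced_exprs\<close>, as
  \<open>dual_step\<close> demands.\<close>

lemma dual_class_eq:
  assumes "\<rho> \<in> reduced_exprs n w"
  shows "dual_class n w \<rho> = {\<sigma>. ck_equiv \<rho> \<sigma>}"
proof -
  have ck: "ck_equiv a b" if "dual_step n w a b" for a b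
    using that dual_equiv_ck unfolding dual_step_def by (auto simp: reduced_exprs_def)
  have 1: "ck_equiv \<rho> \<sigma>" if "equivclp (dual_step n w) \<rho> \<sigma>" for \<sigma>
    using that
  proof (induction rule: equivclp_induct)
    case (step y z)
    then show ?case using ck by (meson equivclp_sym equivclp_trans)
  qed simp
  have st: "dual_step n w a b" if ab: "ck_step a b \<or> ck_step b a" "a \<in> reduced_exprs n w" for a b
  proof -
    obtain u v s t where *: "ck_move s t \<or> ck_move t s" "a = u @ s @ v" "b = u @ t @ v"
      using ab unfolding ck_step_def by blast
    have "length s = 3" using * ck_move_facts by metis
    moreover have "length a = inversion_number n w" using ab by (simp add: reduced_exprs_def)
    ultimately have "length v + 2 < inversion_number n w" using * by simp
    moreover have "b = dual_equiv (length v + 2) a" using * ck_move_dual_equiv by metis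
    ultimately show ?thesis using ab(2) unfolding dual_step_def
      by (metis add_2_eq_Suc' less_Suc_eq_0_disj less_add_Suc2 one_less_numeral_iff semiring_norm(76) trans_less_add2)
  qed
  have 2: "equivclp (dual_step n w) \<rho> \<sigma>" if "ck_equiv \<rho> \<sigma>" for \<sigma>
    using that
  proof (induction rule: equivclp_induct)
    case (step y z)
    have "y \<in> reduced_exprs n w" using reduced_exprs_ck assms step(1) by blast
    then have "dual_step n w y z" using st step(2) by blast
    then show ?case using step by (meson equivclp_into_equivclp)
  qed simp
  show ?thesis using 1 2 reduced_exprs_ck[OF assms] by (auto simp: dual_class_def)
qed

section \<open>Insertion into a line\<close>

text \<open>
  A line is a column of the insertion tableau, stored as the set of its entries. The value
  \<open>bump x R\<close> is junk unless \<open>bumps x R\<close>. The condition \<open>ok x R\<close> is what inserting a letter of a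
  reduced word into a line guarantees.
\<close>

abbreviation bumps :: "nat \<Rightarrow> nat set \<Rightarrow> bool" where
  "bumps x R \<equiv> \<exists>r\<in>R. x < r"

definition bump :: "nat \<Rightarrow> nat set \<Rightarrow> nat" where
  "bump x R = (LEAST r. r \<in> R \<and> x < r)"

text \<open>The Edelman-Greene exception is contained in the first alternative: if \<open>x\<close>
  is already present the column stays as it is, yet \<open>bump x R\<close>, which is
  \<open>Suc x\<close> under \<open>ok\<close>, still moves on.\<close>

definition line_ins :: "nat \<Rightarrow> nat set \<Rightarrow> nat set" where
  "line_ins x R = insert x (if x \<in> R \<or> \<not> bumps x R then R else R - {bump x R})"

abbreviation ok :: "nat \<Rightarrow> nat set \<Rightarrow> bool" where
  "ok x R \<equiv> x \<in> R \<longrightarrow> Suc x \<in> R"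

lemma bump_in: "bumps x R \<Longrightarrow> bump x R \<in> R \<and> x < bump x R"
  unfolding bump_def by (rule LeastI_ex) blast

lemma bump_le: "r \<in> R \<Longrightarrow> x < r \<Longrightarrow> bump x R \<le> r"
  unfolding bump_def by (rule Least_le) simp

lemma bump_eqI: "y \<in> R \<Longrightarrow> x < y \<Longrightarrow> (\<And>r. r \<in> R \<Longrightarrow> x < r \<Longrightarrow> y \<le> r) \<Longrightarrow> bump x R = y"
  unfolding bump_def by (rule Least_equality) auto

lemma bump_ok: "x \<in> R \<Longrightarrow> ok x R \<Longrightarrow> bumps x R \<and> bump x R = Suc x"
  by (auto intro!: bump_eqI)

lemma finite_line_ins [simp]: "finite R \<Longrightarrow> finite (line_ins x R)"
  by (simp add: line_ins_def)

fun line_word :: "nat list \<Rightarrow> nat set \<Rightarrow> nat set" where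
  "line_word [] R = R"
| "line_word (x # w) R = line_ins x (line_word w R)"

text \<open>Words are inserted from the right, and bumped letters are collected in the same order,
  so the result is the word to be inserted into the next column.\<close>

fun bumped :: "nat list \<Rightarrow> nat set \<Rightarrow> nat list" where
  "bumped [] R = []"
| "bumped (x # w) R =
     (if bumps x (line_word w R) then [bump x (line_word w R)] else []) @ bumped w R"

fun ok_word :: "nat list \<Rightarrow> nat set \<Rightarrow> bool" where
  "ok_word [] R \<longleftrightarrow> True"
| "ok_word (x # w) R \<longleftrightarrow> ok x (line_word w R) \<and> ok_word w R"

lemma line_cases:
  assumes "ok x R"
  obtains (append) "x \<notin> R" "\<not> bumps x R" "line_ins x R = insert x R"
  | (replace) y where "x \<notin> R" "bumps x R" "bump x R = y" "y \<in> R" "x < y"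
      "\<And>r. r \<in> R \<Longrightarrow> x < r \<Longrightarrow> y \<le> r" "line_ins x R = insert x (R - {y})"
  | (keep) "x \<in> R" "Suc x \<in> R" "bumps x R" "bump x R = Suc x" "line_ins x R = R"
proof (cases "x \<in> R")
  case True
  then show ?thesis using keep assms bump_ok[of x R] by (auto simp: line_ins_def insert_absorb)
next
  case False
  then show ?thesis using append replace[of "bump x R"] bump_in[of R x] bump_le[of _ R x]
    by (cases "bumps x R") (auto simp: line_ins_def)
qed

text \<open>Together with \<open>bump_after_less\<close> this is Schensted's comparison of two
  successive insertions. It serves both the outer relation and the comparison of recorded
  columns.\<close>

lemma bump_after_greater:
  assumes "x < y" "ok y R"
  shows "bumps x (line_ins y R) \<and> bump x (line_ins y R) \<le> y"
    "bumps y R \<Longrightarrow> bump x (line_ins y R) < bump y R"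
proof -
  have "y \<in> line_ins y R" by (simp add: line_ins_def)
  then show *: "bumps x (line_ins y R) \<and> bump x (line_ins y R) \<le> y"
    using assms(1) bump_le by blast
  show "bump x (line_ins y R) < bump y R" if "bumps y R"
    using * bump_in[OF that] by simp
qed

lemma bump_after_less:
  assumes "x < y" "ok x R" "bumps y (line_ins x R)"
  shows "bumps x R \<and> bump x R < bump y (line_ins x R)"
  using assms(2)
proof (cases rule: line_cases)
  case append
  then show ?thesis using assms by auto
next
  case (replace z)
  then show ?thesis using assms(1) bump_in[OF assms(3)]
    by (metis Diff_iff insertE insertI1 le_neq_implies_less less_trans less_irrefl)
next
  case keep
  then show ?thesis using assms(1) bump_in[OF assms(3)] by auto
qed

lemma bump_cong: "(\<And>r. x < r \<Longrightarrow> r \<in> R \<longleftrightarrow> r \<in> S) \<Longrightarrow> bump x R = bump x S"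
  unfolding bump_def by metis

lemma line_ins_replace:
  assumes "x \<notin> R" "y \<in> R" "x < y" "\<And>r. r \<in> R \<Longrightarrow> x < r \<Longrightarrow> y \<le> r"
  shows "line_ins x R = insert x (R - {y})" "bumps x R" "bump x R = y"
proof -
  show "bump x R = y" using assms bump_eqI by blast
  then show "line_ins x R = insert x (R - {y})" "bumps x R" using assms by (auto simp: line_ins_def)
qed

lemma line_ins_append:
  assumes "x \<notin> R" "\<And>r. r \<in> R \<Longrightarrow> r \<le> x"
  shows "line_ins x R = insert x R" "\<not> bumps x R"
  using assms by (auto simp: line_ins_def not_less)

lemma line_ins_keep: "x \<in> R \<Longrightarrow> line_ins x R = R"
  by (auto simp: line_ins_def)

text \<open>The insertions act on different places: \<open>x\<close> touches only \<open>x\<close>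
  and \<open>bump x R\<close>, which is at most \<open>z\<close>, while \<open>z\<close> touches
  only \<open>z\<close> and something larger. The last hypothesis excludes that \<open>x\<close>
  removes a \<open>z\<close> present in \<open>R\<close>, which would change what \<open>z\<close>
  does.\<close>

lemma line_ins_commute:
  assumes "x < z" "bumps x R" "bump x R \<le> z" "ok x R" "ok z R" "z \<in> R \<longrightarrow> bump x R < z"
  shows "line_ins z (line_ins x R) = line_ins x (line_ins z R)"
    "bumps z (line_ins x R) \<longleftrightarrow> bumps z R" "bump z (line_ins x R) = bump z R"
    "bumps x (line_ins z R)" "bump x (line_ins z R) = bump x R"
proof -
  note b = bump_in[OF assms(2)] bump_le[of _ R x]
  have above: "r \<in> line_ins x R \<longleftrightarrow> r \<in> R" if "z < r" for r
    using that assms by (auto simp: line_ins_def)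
  then show bz: "bumps z (line_ins x R) \<longleftrightarrow> bumps z R" "bump z (line_ins x R) = bump z R"
    by (auto intro: bump_cong)
  have "bumps z R \<longrightarrow> z < bump z R" using bump_in[of R z] by blast
  then have memb: "bump x R \<in> line_ins z R"
    using b assms by (auto simp: line_ins_def)
  have least: "bump x R \<le> r" if "r \<in> line_ins z R" "x < r" for r
    using that b assms by (auto simp: line_ins_def split: if_splits)
  show "bumps x (line_ins z R)" using memb b by blast
  show bx: "bump x (line_ins z R) = bump x R"
    using memb b least by (intro bump_eqI) auto
  \<comment> \<open>\<open>A\<close> and \<open>B\<close> are the entries removed by the insertions
    of \<open>z\<close> and of \<open>x\<close>.\<close>
  define A where "A = (if z \<in> R \<or> \<not> bumps z R then {} else {bump z R})"
  define B where "B = (if x \<in> R then {} else {bump x R})"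
  have "z \<notin> B" "x \<notin> A"
    using assms(1,6) b \<open>bumps z R \<longrightarrow> z < bump z R\<close> by (auto simp: A_def B_def)
  have "z \<in> line_ins x R \<longleftrightarrow> z \<in> R" "x \<in> line_ins z R \<longleftrightarrow> x \<in> R"
    using assms b \<open>bumps z R \<longrightarrow> z < bump z R\<close> by (auto simp: line_ins_def)
  then have "line_ins z (line_ins x R) = insert z (line_ins x R - A)"
    "line_ins x (line_ins z R) = insert x (line_ins z R - B)"
    using bz bx \<open>bumps x (line_ins z R)\<close>
    unfolding line_ins_def[of z "line_ins x R"] line_ins_def[of x "line_ins z R"]
    by (simp_all add: A_def B_def)
  moreover have "line_ins x R = insert x (R - B)" "line_ins z R = insert z (R - A)"
    using assms(2) by (simp_all add: line_ins_def A_def B_def)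
  ultimately show "line_ins z (line_ins x R) = line_ins x (line_ins z R)"
    using \<open>z \<notin> B\<close> \<open>x \<notin> A\<close> by auto
qed

text \<open>Once \<open>y\<close> is in the column, \<open>x\<close> bumps something at most
  \<open>y\<close>, so the insertions of \<open>x\<close> and \<open>z\<close> commute. If
  \<open>z\<close> bumps, so did \<open>y\<close>, and \<open>bump y R\<close> is the witness for
  the bumped letters.\<close>

lemma line_ck_outer:
  assumes "x < y" "y < z" "ok_word [x, z, y] R" "ok_word [z, x, y] R"
  shows "line_word [x, z, y] R = line_word [z, x, y] R \<and>
    (bumped [x, z, y] R = bumped [z, x, y] R \<or> ck_move (bumped [x, z, y] R) (bumped [z, x, y] R))"
proof -
  define S where "S = line_ins y R"
  have ok: "ok y R" "ok x S" "ok z S" using assms by (auto simp: S_def)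
  have x: "bumps x S" "bump x S \<le> y" "bumps y R \<Longrightarrow> bump x S < bump y R"
    unfolding S_def using bump_after_greater[OF assms(1) ok(1)] by auto
  have z: "bumps y R \<and> bump y R < bump z S" if "bumps z S"
    unfolding S_def using bump_after_less[OF assms(2) ok(1)] that by (auto simp: S_def)
  have c: "line_ins z (line_ins x S) = line_ins x (line_ins z S)"
    "bumps z (line_ins x S) \<longleftrightarrow> bumps z S" "bump z (line_ins x S) = bump z S"
    "bumps x (line_ins z S)" "bump x (line_ins z S) = bump x S"
    using line_ins_commute[of x z S] assms(1,2) x(1,2) ok by auto
  have lw: "line_word [x, z, y] R = line_ins x (line_ins z S)"
    "line_word [z, x, y] R = line_ins z (line_ins x S)" by (simp_all add: S_def)
  have b: "bumped [x, z, y] R = bump x S # (if bumps z S then [bump z S] else []) @ bumped [y] R"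
    "bumped [z, x, y] R = (if bumps z S then [bump z S] else []) @ bump x S # bumped [y] R"
    using c x(1) by (simp_all add: S_def)
  show ?thesis
  proof (cases "bumps z S")
    case True
    then have "bumped [y] R = [bump y R]" using z by simp
    then show ?thesis using lw c(1) b z x True ck_move.intros(2)[of "bump x S" "bump y R" "bump z S"]
      by (simp del: bumped.simps line_word.simps)
  next
    case False
    then show ?thesis using lw c(1) b by (simp del: bumped.simps line_word.simps)
  qed
qed

text \<open>Everything depends on what \<open>x\<close> bumps. In the case \<open>far\<close> the
  insertions of \<open>x\<close> and \<open>z\<close> commute. If \<open>x\<close> pushes out a
  \<open>z\<close> of the column, the bumped words differ by a braid. If \<open>x\<close> finds
  nothing up to \<open>z\<close>, a later letter pushes the new \<open>z\<close> out again, and the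
  inner move becomes an outer one or disappears.\<close>

lemma line_ck_inner:
  assumes "x < y" "y < z" "ok_word [y, x, z] R" "ok_word [y, z, x] R"
  shows "line_word [y, x, z] R = line_word [y, z, x] R \<and>
    (bumped [y, x, z] R = bumped [y, z, x] R \<or> ck_move (bumped [y, x, z] R) (bumped [y, z, x] R)
      \<or> ck_move (bumped [y, z, x] R) (bumped [y, x, z] R))"
proof -
  have ok: "ok x R" "ok z R" using assms by auto
  consider (far) "bumps x R" "bump x R \<le> z" "z \<in> R \<longrightarrow> bump x R < z"
    | (braid) "bumps x R" "bump x R = z" "z \<in> R"
    | (near) "\<And>r. r \<in> R \<Longrightarrow> x < r \<Longrightarrow> z < r"
    using bump_in[of R x] bump_le[of _ R x] by (metis le_neq_implies_less not_le order_trans)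
  then show ?thesis
  proof cases
    case far
    define S where "S = line_ins z (line_ins x R)"
    have c: "line_ins x (line_ins z R) = S" "bumps z (line_ins x R) \<longleftrightarrow> bumps z R"
      "bump z (line_ins x R) = bump z R" "bumps x (line_ins z R)" "bump x (line_ins z R) = bump x R"
      unfolding S_def using line_ins_commute[of x z R] assms(1,2) far ok by auto
    have zS: "z \<in> S" by (simp add: S_def line_ins_def)
    then have y: "bumps y S" "bump y S \<le> z" using assms(2) bump_le by auto
    have okx: "ok x (line_ins z R)" using assms by simp
    have 1: "bump x R < bump y S"
      using bump_after_less[OF assms(1) okx] y c by auto
    have 2: "bump y S < bump z R" if "bumps z R" using y bump_in[OF that] by simp
    have "bumped [y, x, z] R = [bump y S, bump x R] @ (if bumps z R then [bump z R] else [])"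
      "bumped [y, z, x] R = [bump y S] @ (if bumps z R then [bump z R] else []) @ [bump x R]"
      "line_word [y, x, z] R = line_ins y S" "line_word [y, z, x] R = line_ins y S"
      using c y(1) far(1) by (simp_all add: S_def[symmetric])
    then show ?thesis
      using 1 2 ck_move.intros(1)[of "bump x R" "bump y S" "bump z R"]
      by (cases "bumps z R") (simp_all del: bumped.simps line_word.simps)
  next
    \<comment> \<open>\<open>ok z R\<close> puts \<open>Suc z\<close> into \<open>R\<close>, so
      \<open>z\<close> and \<open>Suc z\<close> are pushed out alternately: the bumped words are
      \<open>[Suc z, z, Suc z]\<close> and \<open>[z, Suc z, z]\<close>.\<close>
    case braid
    have x: "x \<notin> R" using braid assms bump_ok[of x R] ok by force
    have gap: "z \<le> r" if "r \<in> R" "x < r" for r using bump_le[OF that] braid by simp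
    have zz: "Suc z \<in> R" using braid ok by simp
    have y: "y \<notin> R" using gap assms by fastforce
    have xz: "x < z" using assms by simp
    define S where "S = insert x (R - {z})"
    define T where "T = insert z (S - {Suc z})"
    have 1: "line_ins z R = R" "bumps z R" "bump z R = Suc z"
      using braid zz line_ins_keep[of z R] by (auto intro!: bump_eqI)
    have 2: "line_ins x R = S" using line_ins_replace[of x R z] x braid gap xz by (auto simp: S_def)
    have S: "Suc z \<in> S" "z \<notin> S" "y \<notin> S" using zz xz y assms(1) by (auto simp: S_def)
    have gapS: "Suc z \<le> r" if "r \<in> S" "x < r" for r
      using that gap[of r] by (auto simp: S_def)
    have 3: "line_ins y S = insert y (S - {Suc z})" "bumps y S" "bump y S = Suc z"
      using line_ins_replace[of y S "Suc z"] S gapS assms(1,2) by auto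
    have 4: "line_ins z S = T" "bumps z S" "bump z S = Suc z"
      using line_ins_replace[of z S "Suc z"] S gapS xz by (auto simp: T_def)
    have gapT: "z \<le> r" if "r \<in> T" "x < r" for r
      using that gapS[of r] by (auto simp: T_def)
    have 5: "line_ins y T = insert y (T - {z})" "bumps y T" "bump y T = z"
      using line_ins_replace[of y T z] S gapT assms(1,2) by (auto simp: T_def)
    have "T - {z} = S - {Suc z}" using S by (auto simp: T_def)
    then show ?thesis using 1 2 3 4 5 braid ck_move.intros(3)[of z] by simp
  next
    case near
    have xR: "x \<notin> R" using near[of "Suc x"] ok assms by auto
    have mid: "z \<notin> R" "y \<notin> R" using near[of z] near[of y] assms by auto
    have xz: "x < z" using assms by simp
    show ?thesis
    proof (cases "bumps x R")
      case False
      define S where "S = insert x R"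
      have le: "r \<le> x" if "r \<in> R" for r using False that by (simp add: not_less)
      have lez: "r \<le> z" if "r \<in> R" for r using le[OF that] xz by simp
      have ley: "r \<le> y" if "r \<in> R" for r using le[OF that] assms(1) by simp
      define Z where "Z = insert z R"
      define W where "W = insert z S"
      have 1: "line_ins x R = S" "line_ins z R = Z" "\<not> bumps z R"
        using line_ins_append[of x R] line_ins_append[of z R] xR mid le lez by (auto simp: S_def Z_def)
      have 2: "line_ins x Z = insert x (Z - {z})" "bumps x Z" "bump x Z = z"
        using line_ins_replace[of x Z z] xR False xz by (auto simp: Z_def)
      have leS: "r \<le> z" if "r \<in> S" for r using that lez[of r] xz by (auto simp: S_def)
      have leS': "r \<le> y" if "r \<in> S" for r using that ley[of r] assms(1) by (auto simp: S_def)
      have 3: "line_ins z S = W" "\<not> bumps z S"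
        using line_ins_append[of z S, OF _ leS] mid xz by (simp_all add: S_def W_def)
      have gap: "z \<le> r" if "r \<in> W" "y < r" for r
        using that False assms(1) by (auto simp: S_def W_def)
      have yS: "y \<notin> S" "z \<notin> S" using mid assms by (auto simp: S_def)
      have 4: "line_ins y W = insert y (W - {z})" "bumps y W" "bump y W = z"
        using line_ins_replace[of y W z] yS gap assms(2) by (auto simp: W_def)
      have 5: "insert x (Z - {z}) = S" "W - {z} = S"
        using mid xz yS by (auto simp: S_def Z_def W_def)
      have 6: "line_ins y S = insert y S" "\<not> bumps y S"
        using line_ins_append[of y S, OF _ leS'] yS by simp_all
      show ?thesis using False by (simp add: 1 2 3 4 5 6)
    next
      case True
      define t where "t = bump x R"
      have t: "t \<in> R" "z < t" "\<And>r. r \<in> R \<Longrightarrow> x < r \<Longrightarrow> t \<le> r"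
        using bump_in[OF True] near bump_le by (auto simp: t_def)
      define S where "S = insert x (R - {t})"
      define Z where "Z = insert z (R - {t})"
      have 1: "line_ins x R = S"
        using line_ins_replace[of x R t] xR t xz by (auto simp: S_def)
      have 2: "line_ins z R = Z" "bumps z R" "bump z R = t"
        using line_ins_replace[of z R t] mid t xz by (auto simp: Z_def)
      have gapZ: "z \<le> r" if "r \<in> Z" "x < r" for r
        using that t(2) t(3)[of r] by (auto simp: Z_def)
      have 3: "line_ins x Z = insert x (Z - {z})" "bumps x Z" "bump x Z = z"
        using line_ins_replace[of x Z z] xR gapZ xz by (auto simp: Z_def)
      have 4: "insert x (Z - {z}) = S" using mid xz by (auto simp: S_def Z_def)
      have above: "t < r" if "r \<in> S" "x < r" for r
        using that t(3) by (auto simp: S_def le_neq_implies_less)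
      have yzS: "y \<notin> S" "z \<notin> S" using mid assms(1) xz by (auto simp: S_def)
      have sub: "z < r" if "r \<in> S" "y < r" for r
        using above[OF that(1)] that(2) assms(1) t(2) by simp
      \<comment> \<open>No entry of \<open>S\<close> lies above \<open>y\<close> and up to
        \<open>z\<close>, so both letters bump the same entry.\<close>
      have same: "bumps y S \<longleftrightarrow> bumps z S" "bump y S = bump z S"
      proof -
        have "r \<in> S \<and> y < r \<longleftrightarrow> r \<in> S \<and> z < r" for r using sub[of r] assms(2) by auto
        then show "bumps y S \<longleftrightarrow> bumps z S" "bump y S = bump z S" by (auto simp: bump_def)
      qed
      define U where "U = line_ins z S"
      have zS: "U = insert z (if bumps z S then S - {bump z S} else S)"
        using yzS by (simp add: line_ins_def U_def)
      have yS: "line_ins y S = insert y (if bumps z S then S - {bump z S} else S)"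
        using yzS same by (simp add: line_ins_def)
      have gapU: "z \<le> r" if "r \<in> U" "y < r" for r
        using that sub[of r] by (auto simp: zS split: if_splits)
      have yzU: "y \<notin> U" "z \<in> U" using yzS assms(2) by (auto simp: zS)
      have 5: "line_ins y U = insert y (U - {z})" "bumps y U" "bump y U = z"
        using line_ins_replace[of y U z] assms(2) gapU yzU by auto
      have 6: "insert y (U - {z}) = line_ins y S"
        unfolding yS zS using yzS by auto
      have 7: "t < bump z S" if "bumps z S" using bump_in[OF that] above xz by auto
      have "bumped [y, z, x] R = [z] @ (if bumps z S then [bump z S] else []) @ [t]"
        "bumped [y, x, z] R = (if bumps z S then [bump z S] else []) @ [z, t]"
        "line_word [y, x, z] R = line_ins y S" "line_word [y, z, x] R = line_ins y S"
        using True same 5 by (simp_all add: 1 2 3 4 6 U_def[symmetric] t_def[symmetric])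
      then show ?thesis
        using t(2) 7 ck_move.intros(2)[of z t "bump z S"]
        by (cases "bumps z S") (simp_all del: bumped.simps line_word.simps)
    qed
  qed
qed

text \<open>\<open>ok\<close> leaves three patterns of \<open>x\<close> and \<open>Suc x\<close> in
  the column. If \<open>Suc x\<close> is present, the bumped words form a braid one step higher; if
  neither is, they agree or form an outer move with witness \<open>bump x R\<close>.\<close>

lemma line_ck_braid:
  assumes "ok_word [x, Suc x, x] R" "ok_word [Suc x, x, Suc x] R"
  shows "line_word [x, Suc x, x] R = line_word [Suc x, x, Suc x] R \<and>
    (bumped [x, Suc x, x] R = bumped [Suc x, x, Suc x] R
      \<or> ck_move (bumped [x, Suc x, x] R) (bumped [Suc x, x, Suc x] R)
      \<or> ck_move (bumped [Suc x, x, Suc x] R) (bumped [x, Suc x, x] R))"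
proof -
  have ok: "ok x R" "ok (Suc x) R" using assms by auto
  consider (both) "x \<in> R" "Suc x \<in> R" "Suc (Suc x) \<in> R"
    | (upper) "x \<notin> R" "Suc x \<in> R" "Suc (Suc x) \<in> R"
    | (none) "x \<notin> R" "Suc x \<notin> R"
    using ok by auto
  then show ?thesis
  proof cases
    case both
    have "line_ins x R = R" "line_ins (Suc x) R = R" using both by (simp_all add: line_ins_keep)
    moreover have "bumps x R" "bump x R = Suc x" "bumps (Suc x) R" "bump (Suc x) R = Suc (Suc x)"
      using both by (auto intro!: bump_eqI)
    ultimately show ?thesis using ck_move.intros(3)[of "Suc x"] by simp
  next
    case upper
    define S where "S = insert x (R - {Suc x})"
    define T where "T = insert (Suc x) (S - {Suc (Suc x)})"
    have 1: "line_ins x R = S" "bumps x R" "bump x R = Suc x"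
      using line_ins_replace[of x R "Suc x"] upper by (auto simp: S_def)
    have 2: "line_ins (Suc x) R = R" "bumps (Suc x) R" "bump (Suc x) R = Suc (Suc x)"
      using upper by (auto intro!: bump_eqI line_ins_keep)
    have 3: "line_ins (Suc x) S = T" "bumps (Suc x) S" "bump (Suc x) S = Suc (Suc x)"
      using line_ins_replace[of "Suc x" S "Suc (Suc x)"] upper by (auto simp: S_def T_def)
    have 4: "line_ins x T = T" "bumps x T" "bump x T = Suc x"
      using upper by (auto intro!: bump_eqI line_ins_keep simp: S_def T_def)
    show ?thesis using ck_move.intros(3)[of "Suc x"] by (simp add: 1 2 3 4)
  next
    case none
    show ?thesis
    proof (cases "bumps x R")
      case False
      define S where "S = insert x R"
      define T where "T = insert (Suc x) S"
      define Z where "Z = insert (Suc x) R"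
      have le: "r \<le> x" if "r \<in> R" for r using False that by (simp add: not_less)
      have 1: "line_ins x R = S" unfolding S_def using none le by (intro line_ins_append)
      have nb: "line_ins (Suc x) R = Z" "\<not> bumps (Suc x) R"
        unfolding Z_def using line_ins_append[of "Suc x" R] none le by (auto simp: le_SucI)
      have leS: "r \<le> Suc x" if "r \<in> S" for r using that le[of r] by (auto simp: S_def)
      have 2: "line_ins (Suc x) S = T" "\<not> bumps (Suc x) S"
        unfolding T_def using line_ins_append[of "Suc x" S, OF _ leS] none by (simp_all add: S_def)
      have 3: "line_ins x T = T" "bumps x T" "bump x T = Suc x"
        by (auto intro!: line_ins_keep bump_eqI simp: S_def T_def)
      have 4: "line_ins x Z = insert x (Z - {Suc x})" "bumps x Z" "bump x Z = Suc x"
        using line_ins_replace[of x Z "Suc x"] none False by (auto simp: Z_def)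
      have 5: "insert x (Z - {Suc x}) = S" using none by (auto simp: S_def Z_def)
      show ?thesis using False by (simp add: nb 1 2 3 4 5)
    next
      case True
      define t where "t = bump x R"
      have t: "t \<in> R" "x < t" "\<And>r. r \<in> R \<Longrightarrow> x < r \<Longrightarrow> t \<le> r"
        using bump_in[OF True] bump_le by (auto simp: t_def)
      have tx: "Suc x < t" using none t by (metis Suc_lessI)
      define S where "S = insert x (R - {t})"
      define Z where "Z = insert (Suc x) (R - {t})"
      define U where "U = line_ins (Suc x) S"
      have 1: "line_ins x R = S"
        using line_ins_replace[of x R t] none t by (auto simp: S_def)
      have 2: "line_ins (Suc x) R = Z" "bumps (Suc x) R" "bump (Suc x) R = t"
        using line_ins_replace[of "Suc x" R t] none t tx by (auto simp: Z_def)
      have 3: "line_ins x Z = insert x (Z - {Suc x})" "bumps x Z" "bump x Z = Suc x"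
        using line_ins_replace[of x Z "Suc x"] none by (auto simp: Z_def)
      have 4: "insert x (Z - {Suc x}) = S" using none by (auto simp: S_def Z_def)
      have xS: "x \<in> S" by (simp add: S_def)
      have "bumps (Suc x) S \<longrightarrow> Suc x < bump (Suc x) S" using bump_in by blast
      then have in5: "x \<in> U" "Suc x \<in> U"
        using xS \<open>bumps (Suc x) S \<longrightarrow> Suc x < bump (Suc x) S\<close> by (auto simp: line_ins_def U_def)
      then have 5: "line_ins x U = U" "bumps x U" "bump x U = Suc x"
        by (auto intro!: line_ins_keep bump_eqI)
      have 6: "t < bump (Suc x) S" if "bumps (Suc x) S"
        using bump_in[OF that] t(3) by (auto simp: S_def le_neq_implies_less)
      have "bumped [x, Suc x, x] R = [Suc x] @ (if bumps (Suc x) S then [bump (Suc x) S] else []) @ [t]"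
        "bumped [Suc x, x, Suc x] R = (if bumps (Suc x) S then [bump (Suc x) S] else []) @ [Suc x, t]"
        "line_word [x, Suc x, x] R = U" "line_word [Suc x, x, Suc x] R = U"
        using True 5 by (simp_all add: 1 2 3 4 U_def[symmetric] t_def[symmetric])
      then show ?thesis
        using tx 6 ck_move.intros(2)[of "Suc x" t "bump (Suc x) S"]
        by (cases "bumps (Suc x) S") (simp_all del: bumped.simps line_word.simps)
    qed
  qed
qed

lemma line_ck:
  assumes "ck_move s t" "ok_word s R" "ok_word t R"
  shows "line_word s R = line_word t R \<and> (bumped s R = bumped t R \<or>
    ck_move (bumped s R) (bumped t R) \<or> ck_move (bumped t R) (bumped s R))"
  using assms(1)
proof cases
  case (1 x y z)
  then show ?thesis using line_ck_inner[of x y z R] assms by blast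
next
  case (2 x y z)
  then show ?thesis using line_ck_outer[of x y z R] assms by blast
next
  case (3 x)
  then show ?thesis using line_ck_braid[of x R] assms by blast
qed

section \<open>Tableau insertion\<close>

text \<open>The column read from top to bottom in French notation.\<close>

definition desc :: "nat set \<Rightarrow> nat list" where
  "desc R = rev (sorted_list_of_set R)"

lemma desc_eqI:
  assumes "sorted_wrt (>) xs" "set xs = R"
  shows "desc R = xs"
proof -
  have "sorted_wrt (<) (rev xs)" using assms(1) by (simp add: sorted_wrt_rev)
  moreover from this have "distinct (rev xs)" by (simp add: strict_sorted_iff)
  ultimately have "sorted_list_of_set R = rev xs"
    using sorted_list_of_set_unique[of R "rev xs"] assms(2) distinct_card[of "rev xs"] by auto
  then show ?thesis by (simp add: desc_def)
qed

lemma desc_props [simp]: "finite R \<Longrightarrow> sorted_wrt (\<lambda>x y. y < x) (desc R)" "finite R \<Longrightarrow> set (desc R) = R"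
  by (simp_all add: desc_def sorted_wrt_rev)

lemma desc_empty [simp]: "desc {} = []"
  by (simp add: desc_def)

lemma desc_split:
  assumes "finite R" "y \<in> R"
  shows "desc R = desc {r \<in> R. y < r} @ y # desc {r \<in> R. r < y}"
proof -
  define M A where "M = {r \<in> R. y < r}" and "A = {r \<in> R. r < y}"
  have f: "finite M" "finite A" using assms by (simp_all add: M_def A_def)
  have "desc R = desc M @ y # desc A"
  proof (rule desc_eqI)
    show "sorted_wrt (>) (desc M @ y # desc A)"
      by (simp add: sorted_wrt_append f) (auto simp: M_def A_def)
    show "set (desc M @ y # desc A) = R"
      using assms(2) by (simp add: f) (auto simp: M_def A_def)
  qed
  then show ?thesis by (simp only: M_def A_def)
qed

text \<open>Outer moves: \<open>x\<close> passes \<open>m\<close> because the letter after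
  \<open>m\<close> lies between them in value. The last letter \<open>y\<close> is never passed; it
  is the final witness.\<close>

lemma ck_pass_greater:
  assumes "sorted_wrt (>) (ms @ [y])" "x < y"
  shows "ck_equiv (x # ms @ [y]) (ms @ [x, y])"
  using assms(1)
proof (induction ms)
  case (Cons m ms)
  obtain m' rest where m': "ms @ [y] = m' # rest" by (cases ms) auto
  then have "m' < m" "x < m'" using Cons.prems assms(2)
    by (cases ms; auto)+
  then have "ck_move [x, m, m'] [m, x, m']" by (intro ck_move.intros)
  from ck_move_equiv[OF this, of "[]" rest]
  have "ck_equiv (x # m # ms @ [y]) (m # x # ms @ [y])" using m' by simp
  also have "ck_equiv (m # x # ms @ [y]) (m # ms @ [x, y])"
    using ck_equiv_context[of "x # ms @ [y]" "ms @ [x, y]" "[m]" "[]"] Cons by simp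
  finally show ?case by simp
qed simp

text \<open>Inner moves: \<open>y\<close> passes \<open>a\<close> with the letter \<open>x\<close>
  in front as witness; then \<open>a\<close> takes over as witness.\<close>

lemma ck_pass_less:
  assumes "sorted_wrt (>) (x # as)" "x < y"
  shows "ck_equiv (x # y # as) (x # as @ [y])"
  using assms
proof (induction as arbitrary: x)
  case (Cons a as)
  then have "ck_move [x, a, y] [x, y, a]" by (intro ck_move.intros) auto
  from equivclp_sym[OF ck_move_equiv[OF this, of "[]" as]]
  have "ck_equiv (x # y # a # as) (x # a # y # as)" by simp
  also have "ck_equiv (x # a # y # as) (x # a # as @ [y])"
    using ck_equiv_context[of "a # y # as" "a # as @ [y]" "[x]" "[]"] Cons by simp
  finally show ?case by simp
qed simp

text \<open>Insertion is carried out by moves: \<open>x\<close> travels to the entry it displaces,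
  and that entry travels out to the end. In the exceptional case \<open>x\<close> meets
  \<open>Suc x, x\<close>, and a braid move makes \<open>Suc x\<close> the outgoing letter.\<close>

lemma ck_line:
  assumes fin: "finite R" and ok: "ok x R"
  shows "bumps x R \<Longrightarrow> ck_equiv (x # desc R) (desc (line_ins x R) @ [bump x R])"
    and "\<not> bumps x R \<Longrightarrow> desc (line_ins x R) = x # desc R"
  using ok
proof (atomize(full), cases rule: line_cases)
  case append
  then have "desc (insert x R) = x # desc R"
    using fin by (intro desc_eqI) (auto simp: not_less le_less)
  then show "(bumps x R \<longrightarrow> ck_equiv (x # desc R) (desc (line_ins x R) @ [bump x R])) \<and>
    (\<not> bumps x R \<longrightarrow> desc (line_ins x R) = x # desc R)" using append by simp
next
  case (replace y)
  define M A where "M = {r \<in> R. y < r}" and "A = {r \<in> R. r < y}"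
  have f: "finite M" "finite A" using fin by (simp_all add: M_def A_def)
  have A: "a < x" if "a \<in> A" for a
    using that replace(1) replace(6)[of a] by (metis (mono_tags, lifting) A_def linorder_neqE_nat mem_Collect_eq not_le)
  have dR: "desc R = desc M @ y # desc A"
    unfolding M_def A_def using fin replace(4) by (rule desc_split)
  have dI: "desc (line_ins x R) = desc M @ x # desc A"
    unfolding replace(7)
  proof (rule desc_eqI)
    show "sorted_wrt (>) (desc M @ x # desc A)"
      using A replace(5) by (simp add: sorted_wrt_append f) (force simp: M_def)
    show "set (desc M @ x # desc A) = insert x (R - {y})"
      by (simp add: f) (auto simp: M_def A_def)
  qed
  have "ck_equiv (x # desc M @ [y]) (desc M @ [x, y])"
    using replace(5) by (intro ck_pass_greater) (simp_all add: sorted_wrt_append f, simp add: M_def)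
  from ck_equiv_context[OF this, of "[]" "desc A"]
  have "ck_equiv (x # desc R) (desc M @ x # y # desc A)" by (simp add: dR)
  also have "ck_equiv (x # y # desc A) (x # desc A @ [y])"
    using A replace(5) by (intro ck_pass_less) (simp_all add: f)
  from ck_equiv_context[OF this, of "desc M" "[]"]
  have "ck_equiv (desc M @ x # y # desc A) (desc (line_ins x R) @ [y])" by (simp add: dI)
  finally show "(bumps x R \<longrightarrow> ck_equiv (x # desc R) (desc (line_ins x R) @ [bump x R])) \<and>
    (\<not> bumps x R \<longrightarrow> desc (line_ins x R) = x # desc R)" using replace(2,3) by simp
next
  case keep
  define M A where "M = {r \<in> R. Suc x < r}" and "A = {r \<in> R. r < x}"
  have f: "finite M" "finite A" using fin by (simp_all add: M_def A_def)
  have dR: "desc R = desc M @ Suc x # x # desc A"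
  proof (rule desc_eqI)
    show "sorted_wrt (>) (desc M @ Suc x # x # desc A)"
      by (simp add: sorted_wrt_append f) (auto simp: M_def A_def)
    show "set (desc M @ Suc x # x # desc A) = R"
      using keep(1,2) by (simp add: f) (auto simp: M_def A_def)
  qed
  have "ck_equiv (x # desc M @ [Suc x]) (desc M @ [x, Suc x])"
    by (intro ck_pass_greater) (simp_all add: sorted_wrt_append f, simp add: M_def)
  from ck_equiv_context[OF this, of "[]" "x # desc A"]
  have "ck_equiv (x # desc R) (desc M @ [x, Suc x, x] @ desc A)" by (simp add: dR)
  also have "ck_equiv (desc M @ [x, Suc x, x] @ desc A) (desc M @ [Suc x, x, Suc x] @ desc A)"
    by (rule ck_move_equiv[OF ck_move.intros(3)])
  also have "ck_equiv (x # Suc x # desc A) (x # desc A @ [Suc x])"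
    by (intro ck_pass_less) (simp_all add: f, simp add: A_def)
  from ck_equiv_context[OF this, of "desc M @ [Suc x]" "[]"]
  have "ck_equiv (desc M @ [Suc x, x, Suc x] @ desc A) (desc R @ [Suc x])" by (simp add: dR)
  finally show "(bumps x R \<longrightarrow> ck_equiv (x # desc R) (desc (line_ins x R) @ [bump x R])) \<and>
    (\<not> bumps x R \<longrightarrow> desc (line_ins x R) = x # desc R)" using keep(3-5) by simp
qed

text \<open>If \<open>x\<close> were present without \<open>Suc x\<close>, all entries read before
  it would exceed \<open>Suc x\<close> and commute with \<open>x\<close>, so the two copies of
  \<open>x\<close> would cancel.\<close>

lemma reduced_ok:
  assumes fin: "finite R" and red: "reduced (x # desc R)"
  shows "ok x R"
proof (rule ccontr)
  assume "\<not> ok x R"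
  then have x: "x \<in> R" "Suc x \<notin> R" by auto
  define M where "M = {r \<in> R. x < r}"
  have "\<forall>m\<in>set (desc M). Suc x < m \<or> Suc m < x"
    using x(2) fin by (auto simp: M_def intro: Suc_lessI)
  from not_reduced_commuting[OF this, of "[]"] show False
    using red desc_split[OF fin x(1)] by (simp add: M_def)
qed

text \<open>The mirror image, for undoing a bump: the entries read after \<open>y\<close> would be
  less than \<open>y - 1\<close> and commute with the trailing \<open>y\<close>.\<close>

lemma reduced_ok_reverse:
  assumes fin: "finite R" and red: "reduced (desc R @ [y])" and r: "r \<in> R" "r < y"
  shows "y \<in> R \<longrightarrow> y - 1 \<in> R"
proof (rule ccontr)
  assume "\<not> ?thesis"
  then have y: "y \<in> R" "y - 1 \<notin> R" by auto
  define A where "A = {r \<in> R. r < y}"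
  have "\<forall>m\<in>set (desc A). Suc y < m \<or> Suc m < y"
  proof
    fix m assume "m \<in> set (desc A)"
    then have "m \<in> R" "m < y" using fin by (auto simp: A_def)
    then show "Suc y < m \<or> Suc m < y" using y(2) by (metis Suc_lessI diff_Suc_1)
  qed
  from not_reduced_commuting[OF this, of "desc {r \<in> R. y < r}" "[]"] show False
    using red desc_split[OF fin y(1)] by (simp add: A_def)
qed

lemma finite_line_word: "finite R \<Longrightarrow> finite (line_word w R)"
  by (induction w) simp_all

lemma line_word_ck:
  assumes "finite R" "reduced (w @ desc R)"
  shows "ok_word w R \<and> ck_equiv (w @ desc R) (desc (line_word w R) @ bumped w R)"
  using assms(2)
proof (induction w)
  case (Cons x w)
  let ?R = "line_word w R"
  have red: "reduced (w @ desc R)" using Cons.prems reduced_suffix[of "[x]"] by simp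
  note IH = Cons.IH[OF red]
  have 1: "ck_equiv (x # w @ desc R) (x # desc ?R @ bumped w R)"
    using ck_equiv_context[OF conjunct2[OF IH], of "[x]" "[]"] by simp
  then have "reduced (x # desc ?R @ bumped w R)" using Cons.prems ck_equiv_reduced by simp
  then have "reduced (x # desc ?R)" using reduced_prefix[of "x # desc ?R"] by simp
  then have ok: "ok x ?R" using finite_line_word[OF assms(1)] reduced_ok by blast
  have "ck_equiv (x # desc ?R @ bumped w R) (desc (line_word (x # w) R) @ bumped (x # w) R)"
  proof (cases "bumps x ?R")
    case True
    from ck_equiv_context[OF ck_line(1)[OF finite_line_word[OF assms(1)] ok True], of "[]" "bumped w R"]
    show ?thesis using True by simp
  next
    case False
    then show ?thesis using ck_line(2)[OF finite_line_word[OF assms(1)] ok False] by simp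
  qed
  then have "ck_equiv (x # w @ desc R) (desc (line_word (x # w) R) @ bumped (x # w) R)"
    by (rule equivclp_trans[OF 1])
  then show ?case using ok IH by simp
qed simp

section \<open>Insertion through all columns\<close>

fun ins :: "nat \<Rightarrow> nat set list \<Rightarrow> nat set list" where
  "ins x [] = [{x}]"
| "ins x (R # Rs) = line_ins x R # (if bumps x R then ins (bump x R) Rs else Rs)"

fun pos :: "nat \<Rightarrow> nat set list \<Rightarrow> nat" where
  "pos x [] = 0"
| "pos x (R # Rs) = (if bumps x R then Suc (pos (bump x R) Rs) else 0)"

fun ok_ins :: "nat \<Rightarrow> nat set list \<Rightarrow> bool" where
  "ok_ins x [] \<longleftrightarrow> True"
| "ok_ins x (R # Rs) \<longleftrightarrow> ok x R \<and> (bumps x R \<longrightarrow> ok_ins (bump x R) Rs)"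

definition reading :: "nat set list \<Rightarrow> nat list" where
  "reading Rs = concat (map desc Rs)"

lemma reading_simps [simp]: "reading [] = []" "reading (R # Rs) = desc R @ reading Rs"
  by (simp_all add: reading_def)

text \<open>Exchanges insertion letter by letter for insertion column by column, so that a move can
  be followed through one column at a time.\<close>

lemma foldr_ins_Cons:
  "foldr ins w (R # Rs) = line_word w R # foldr ins (bumped w R) Rs"
  by (induction w) auto

lemma finite_ins: "\<forall>R\<in>set Rs. finite R \<Longrightarrow> \<forall>R\<in>set (ins x Rs). finite R"
  by (induction x Rs rule: ins.induct) auto

text \<open>By \<open>ck_line\<close> the word is equivalent to one with \<open>bump x R\<close> in
  front of the remaining reading word, which hands reducedness on to the next column.\<close>

lemma reduced_ok_ins:
  assumes "\<forall>R\<in>set Rs. finite R" "reduced (x # reading Rs)"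
  shows "ok_ins x Rs"
  using assms
proof (induction x Rs rule: ins.induct)
  case (2 x R Rs)
  have fin: "finite R" using 2 by simp
  have "reduced (x # desc R)" using 2(3) reduced_prefix[of "x # desc R"] by simp
  then have ok: "ok x R" using reduced_ok fin by blast
  have "ok_ins (bump x R) Rs" if "bumps x R"
  proof -
    have "ck_equiv (x # desc R @ reading Rs) (desc (line_ins x R) @ bump x R # reading Rs)"
      using ck_equiv_context[OF ck_line(1)[OF fin ok that], of "[]" "reading Rs"] by simp
    then have "reduced (desc (line_ins x R) @ bump x R # reading Rs)"
      using 2(3) ck_equiv_reduced by simp
    then have "reduced (bump x R # reading Rs)" by (rule reduced_suffix)
    then show ?thesis using 2(1)[OF that] 2(2) by simp
  qed
  then show ?case using ok by simp
qed simp

lemma ins_ck: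
  assumes "\<forall>R\<in>set Rs. finite R" "ok_ins x Rs"
  shows "ck_equiv (x # reading Rs) (reading (ins x Rs))"
  using assms
proof (induction x Rs rule: ins.induct)
  case (1 x)
  have "desc {x} = [x]" by (intro desc_eqI) auto
  then show ?case by simp
next
  case (2 x R Rs)
  have fin: "finite R" and ok: "ok x R" using 2 by simp_all
  show ?case
  proof (cases "bumps x R")
    case True
    have "ck_equiv (x # desc R @ reading Rs) (desc (line_ins x R) @ bump x R # reading Rs)"
      using ck_equiv_context[OF ck_line(1)[OF fin ok True], of "[]" "reading Rs"] by simp
    also have "ck_equiv (bump x R # reading Rs) (reading (ins (bump x R) Rs))"
      using 2 True by simp
    from ck_equiv_context[OF this, of "desc (line_ins x R)" "[]"]
    have "ck_equiv (desc (line_ins x R) @ bump x R # reading Rs)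
        (desc (line_ins x R) @ reading (ins (bump x R) Rs))" by simp
    finally show ?thesis using True by simp
  next
    case False
    then show ?thesis using ck_line(2)[OF fin ok False] by simp
  qed
qed

text \<open>Each line turns a move into a move of the bumped words or into equal bumped words, which
  are inserted into the remaining lines.\<close>

lemma foldr_ins_ck_move:
  assumes "\<forall>R\<in>set Rs. finite R" "ck_move s t" "reduced (s @ reading Rs)"
  shows "foldr ins s Rs = foldr ins t Rs"
  using assms
proof (induction Rs arbitrary: s t)
  case Nil
  \<comment> \<open>The first letter put into an empty column bumps nothing. So the bumped words
    have fewer than three letters, cannot be related by a move, and must be equal by
    \<open>line_ck\<close>.\<close>
  have "length (bumped w {}) \<le> length w - 1" for w
  proof (induction w)
    case (Cons x w)
    then show ?case by (cases w) auto
  qed simp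
  then have "length (bumped s {}) < 3" "length (bumped t {}) < 3"
    using ck_move_facts[OF Nil(2)] by (metis Suc_1 diff_Suc_1 less_Suc_eq_le numeral_3_eq_3)+
  then have no: "\<not> ck_move (bumped s {}) (bumped t {})" "\<not> ck_move (bumped t {}) (bumped s {})"
    using ck_move_facts(4) by fastforce+
  have red: "reduced (s @ desc {})" "reduced (t @ desc {})"
    using Nil(3) reduced_cong[OF ck_move_facts(1,2)[OF Nil(2)]] by simp_all
  have "line_word s {} = line_word t {} \<and> bumped s {} = bumped t {}"
    using line_ck[OF Nil(2), of "{}"] line_word_ck[OF _ red(1)] line_word_ck[OF _ red(2)] no by auto
  moreover have "foldr ins w [] = line_word w {} # foldr ins (bumped w {}) []" if "w \<noteq> []" for w
    using that
  proof (induction w)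
    case (Cons x w)
    then show ?case by (cases w) (auto simp: line_ins_def)
  qed simp
  moreover have "s \<noteq> []" "t \<noteq> []" using ck_move_facts[OF Nil(2)] by auto
  ultimately show ?case by metis
next
  case (Cons R Rs)
  have fin: "finite R" using Cons.prems by simp
  note facts = ck_move_facts[OF Cons.prems(2)]
  have red2: "reduced (t @ desc R @ reading Rs)"
    using Cons.prems(3) facts reduced_cong[of "s @ desc R @ reading Rs" "t @ desc R @ reading Rs"] by simp
  have reds: "reduced (s @ desc R)" "reduced (t @ desc R)"
    using Cons.prems(3) red2 reduced_prefix[of "s @ desc R"] reduced_prefix[of "t @ desc R"] by simp_all
  note s = line_word_ck[OF fin reds(1)] and t = line_word_ck[OF fin reds(2)]
  have "reduced (desc (line_word s R) @ bumped s R @ reading Rs)"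
    using ck_equiv_context[OF conjunct2[OF s], of "[]" "reading Rs"] Cons.prems(3) ck_equiv_reduced by simp
  then have s': "reduced (bumped s R @ reading Rs)" by (rule reduced_suffix)
  have "reduced (desc (line_word t R) @ bumped t R @ reading Rs)"
    using ck_equiv_context[OF conjunct2[OF t], of "[]" "reading Rs"] red2 ck_equiv_reduced by simp
  then have t': "reduced (bumped t R @ reading Rs)" by (rule reduced_suffix)
  have "foldr ins (bumped s R) Rs = foldr ins (bumped t R) Rs"
    if "ck_move (bumped s R) (bumped t R) \<or> ck_move (bumped t R) (bumped s R)"
    using that Cons.IH[of "bumped s R" "bumped t R"] Cons.IH[of "bumped t R" "bumped s R"]
      Cons.prems(1) s' t' by auto
  then show ?case using line_ck[OF Cons.prems(2), of R] s t by (auto simp: foldr_ins_Cons)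
qed

section \<open>The insertion tableau as an invariant of the class\<close>

definition P_tab :: "nat list \<Rightarrow> nat set list" where
  "P_tab \<rho> = foldr ins \<rho> []"

text \<open>The latest letter comes first, as in the word itself; reversed, this lists the columns
  of the entries 1, 2, ... of the recording tableau.\<close>

fun Q_word :: "nat list \<Rightarrow> nat list" where
  "Q_word [] = []"
| "Q_word (x # \<rho>) = pos x (P_tab \<rho>) # Q_word \<rho>"

lemma P_tab_simps [simp]: "P_tab [] = []" "P_tab (x # \<rho>) = ins x (P_tab \<rho>)"
  by (simp_all add: P_tab_def)

lemma finite_P_tab: "\<forall>R\<in>set (P_tab \<rho>). finite R"
  by (induction \<rho>) (simp_all add: finite_ins)

lemma P_tab_ck_reading: "reduced \<rho> \<Longrightarrow> ck_equiv \<rho> (reading (P_tab \<rho>))"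
proof (induction \<rho>)
  case (Cons x \<rho>)
  have "reduced \<rho>" using Cons.prems reduced_suffix[of "[x]" \<rho>] by simp
  then have 1: "ck_equiv (x # \<rho>) (x # reading (P_tab \<rho>))"
    using ck_equiv_context[OF Cons.IH, of "[x]" "[]"] by simp
  then have "reduced (x # reading (P_tab \<rho>))" using Cons.prems ck_equiv_reduced by blast
  then show ?case
    using ins_ck[OF finite_P_tab reduced_ok_ins[OF finite_P_tab]] 1 by (auto intro: equivclp_trans)
qed simp

lemma P_tab_ok_ins:
  assumes "reduced (x # \<rho>)"
  shows "ok_ins x (P_tab \<rho>)"
proof -
  have "reduced \<rho>" using assms reduced_suffix[of "[x]" \<rho>] by simp
  then have "ck_equiv (x # \<rho>) (x # reading (P_tab \<rho>))"
    using ck_equiv_context[OF P_tab_ck_reading, of \<rho> "[x]" "[]"] by simp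
  then show ?thesis using reduced_ok_ins[OF finite_P_tab] assms ck_equiv_reduced by blast
qed

lemma P_tab_ck_step:
  assumes "ck_step \<rho> \<sigma>" "reduced \<rho>"
  shows "P_tab \<rho> = P_tab \<sigma>"
proof -
  obtain u v s t where *: "ck_move s t" "\<rho> = u @ s @ v" "\<sigma> = u @ t @ v"
    using assms(1) unfolding ck_step_def by blast
  have "reduced (s @ v)" using assms(2) * reduced_suffix by blast
  then have "reduced (s @ reading (P_tab v))"
    using ck_equiv_context[OF P_tab_ck_reading, of v s "[]"] reduced_suffix[of s v] ck_equiv_reduced by simp
  from foldr_ins_ck_move[OF finite_P_tab *(1) this] show ?thesis
    by (simp add: P_tab_def *(2,3))
qed

lemma P_tab_ck_equiv:
  assumes "ck_equiv \<rho> \<sigma>" "reduced \<rho>"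
  shows "P_tab \<rho> = P_tab \<sigma>"
  using assms(1)
proof (induction rule: equivclp_induct)
  case (step y z)
  then have "reduced y" "reduced z"
    using assms(2) ck_equiv_reduced by (meson equivclp_into_equivclp)+
  then show ?case using step P_tab_ck_step by metis
qed simp

text \<open>Two reduced words with the same tableau are both equivalent to its reading word; the
  other direction is invariance under moves.\<close>

lemma ck_equiv_iff_P_tab:
  assumes "reduced \<rho>"
  shows "ck_equiv \<rho> \<sigma> \<longleftrightarrow> reduced \<sigma> \<and> P_tab \<sigma> = P_tab \<rho>"
proof
  assume "ck_equiv \<rho> \<sigma>"
  then show "reduced \<sigma> \<and> P_tab \<sigma> = P_tab \<rho>" using assms P_tab_ck_equiv ck_equiv_reduced by metis
next
  assume "reduced \<sigma> \<and> P_tab \<sigma> = P_tab \<rho>"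
  then show "ck_equiv \<rho> \<sigma>"
    using P_tab_ck_reading assms by (metis equivclp_sym equivclp_trans)
qed

section \<open>Recording words\<close>

definition below :: "nat set \<Rightarrow> nat \<Rightarrow> nat" where
  "below R z = card (R \<inter> {..<z})"

text \<open>
  Equivalently, the \<open>i\<close>-th smallest entry of \<open>R\<close> exists and is smaller than that of \<open>S\<close>, for
  every \<open>i\<close> up to the size of \<open>S\<close>.
\<close>

definition dominates :: "nat set \<Rightarrow> nat set \<Rightarrow> bool" where
  "dominates R S \<longleftrightarrow> (\<forall>z. below S (Suc z) \<le> below R z)"

lemma below_Suc: "below R (Suc z) = below R z + of_bool (z \<in> R)"
  by (simp add: below_def lessThan_Suc Int_insert_right)

lemma below_mono: "z \<le> z' \<Longrightarrow> below R z \<le> below R z'"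
  unfolding below_def by (rule card_mono) auto

lemma below_le_card: "finite R \<Longrightarrow> below R z \<le> card R"
  unfolding below_def by (rule card_mono) auto

lemma below_subset: "R \<subseteq> R' \<Longrightarrow> below R z \<le> below R' z"
  unfolding below_def by (rule card_mono) auto

lemma below_gap:
  assumes "z \<le> z'" "\<And>r. r \<in> R \<Longrightarrow> z \<le> r \<Longrightarrow> r < z' \<Longrightarrow> False"
  shows "below R z' = below R z"
proof -
  have "R \<inter> {..<z'} = R \<inter> {..<z}" using assms by (auto simp: not_le[symmetric])
  then show ?thesis by (simp add: below_def)
qed

lemma below_insert: "x \<notin> R \<Longrightarrow> below (insert x R) z = below R z + of_bool (x < z)"
  by (simp add: below_def Int_insert_left)

text \<open>Insertion moves an entry down from \<open>bump x R\<close> to \<open>x\<close>, adds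
  \<open>x\<close> on top, or changes nothing; the count rises by one exactly at the thresholds
  crossed.\<close>

lemma below_line_ins:
  assumes "ok x R"
  shows "below (line_ins x R) z =
    below R z + of_bool (x \<notin> R \<and> x < z \<and> (bumps x R \<longrightarrow> z \<le> bump x R))"
  using assms
proof (cases rule: line_cases)
  case append
  then show ?thesis by (simp add: below_insert)
next
  case (replace y)
  have "below R z = below (R - {y}) z + of_bool (y < z)"
    using below_insert[of y "R - {y}" z] replace(4) by (simp add: insert_absorb)
  moreover have "below (insert x (R - {y})) z = below (R - {y}) z + of_bool (x < z)"
    using replace(1) by (simp add: below_insert)
  ultimately show ?thesis using replace(1,2,3,5,7) by auto
qed simp

text \<open>Only thresholds where the count of the second column rises are at risk. There
  \<open>S\<close> has no entry from \<open>bump x R\<close> up to \<open>z\<close>, and the missing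
  unit comes from \<open>x\<close> if \<open>z\<close> is \<open>bump x R\<close>, and from
  \<open>bump x R\<close> itself if \<open>z\<close> is larger.\<close>

lemma dominates_ins:
  assumes dom: "dominates R S" and x: "ok x R" "bumps x R" and y: "ok (bump x R) S"
  shows "dominates (line_ins x R) (line_ins (bump x R) S)"
  unfolding dominates_def
proof
  fix z
  let ?y = "bump x R"
  have D: "below S (Suc z) \<le> below R z" for z using dom by (simp add: dominates_def)
  note b = bump_in[OF x(2)]
  show "below (line_ins ?y S) (Suc z) \<le> below (line_ins x R) z"
  proof (cases "?y \<notin> S \<and> ?y < Suc z \<and> (bumps ?y S \<longrightarrow> Suc z \<le> bump ?y S)")
    case False
    then show ?thesis using D[of z] by (auto simp: below_line_ins x y)
  next
    case True
    have "False" if "r \<in> S" "?y \<le> r" "r < Suc z" for r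
    proof -
      have "?y < r" using that True by (auto simp: le_less)
      then show False using True bump_le[of r S ?y] that by auto
    qed
    then have S: "below S (Suc z) = below S ?y" using True by (intro below_gap) auto
    have "below S ?y + 1 \<le> below (line_ins x R) z"
    proof (cases "z = ?y")
      case z: True
      show ?thesis
      proof (cases "x \<in> R")
        case False
        have "below S ?y \<le> below R ?y" using D[of ?y] below_mono[of ?y "Suc ?y" S] by simp
        then show ?thesis using False z b x by (simp add: below_line_ins)
      next
        case True
        then have y': "?y = Suc x" using bump_ok x by blast
        then have "below S ?y \<le> below R x" using D[of x] by simp
        moreover have "below (line_ins x R) z = below R (Suc x)"
          using below_line_ins[OF x(1), of z] True z y' by simp
        ultimately show ?thesis using True by (simp add: below_Suc)
      qed
    next
      case False
      have "below S ?y \<le> below R ?y" using D[of ?y] below_mono[of ?y "Suc ?y" S] by simp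
      moreover have "below R (Suc ?y) \<le> below R z" using False True by (intro below_mono) auto
      moreover have "below R (Suc ?y) = below R ?y + 1" using b by (simp add: below_Suc)
      ultimately show ?thesis using x by (simp add: below_line_ins)
    qed
    then show ?thesis using True S y by (simp add: below_line_ins)
  qed
qed

text \<open>Only thresholds above \<open>x\<close> and up to \<open>bump x R\<close> are at risk,
  where the first column had gained a unit. The new first column has no entry in that range, so its
  count there can be read off at \<open>bump x R\<close> or one or two steps later, where the second
  column has an extra entry.\<close>

lemma dominates_ins_reverse:
  assumes dom: "dominates (line_ins x R) (line_ins (bump x R) S)"
    and x: "ok x R" "bumps x R" and y: "ok (bump x R) S"
  shows "dominates R S"
  unfolding dominates_def
proof
  fix z
  let ?y = "bump x R"
  let ?R = "line_ins x R" and ?S = "line_ins ?y S"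
  have D: "below ?S (Suc z) \<le> below ?R z" for z using dom by (simp add: dominates_def)
  have SS: "below S z \<le> below ?S z" for z using y by (simp add: below_line_ins)
  note b = bump_in[OF x(2)]
  show "below S (Suc z) \<le> below R z"
  proof (cases "x \<notin> R \<and> x < z \<and> z \<le> ?y")
    case False
    then have "below ?R z = below R z" using x by (auto simp: below_line_ins)
    then show ?thesis using D[of z] SS[of "Suc z"] by simp
  next
    case True
    have gapR: "r \<in> ?R \<Longrightarrow> x < r \<Longrightarrow> ?y < r" for r
      using True x(2) bump_le[of r R x] by (auto simp: line_ins_def le_less)
    have R1: "below ?R ?y = below ?R z" "below ?R (Suc ?y) = below ?R z"
      using True by (auto intro!: below_gap dest: gapR)
    have "below S (Suc z) + 1 \<le> below ?R z"
    proof (cases "z = ?y")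
      case z: True
      show ?thesis
      proof (cases "?y \<in> S")
        case False
        have yb: "bumps ?y S \<longrightarrow> Suc ?y \<le> bump ?y S" by (meson Suc_leI bump_in)
        then have "below ?S (Suc ?y) = below S (Suc ?y) + 1"
          using False y yb by (simp add: below_line_ins)
        then show ?thesis using D[of ?y] z by simp
      next
        case yS: True
        have "below S (Suc (Suc ?y)) = below S (Suc ?y) + 1"
          using y yS by (simp add: below_Suc[of S "Suc ?y"])
        then show ?thesis using D[of "Suc ?y"] SS[of "Suc (Suc ?y)"] R1(2) unfolding z by linarith
      qed
    next
      case False
      have "?y \<in> ?S" by (simp add: line_ins_def)
      then have "below ?S (Suc ?y) = below ?S ?y + 1" by (simp add: below_Suc)
      moreover have "below S (Suc z) \<le> below ?S ?y"
        using SS[of "Suc z"] below_mono[of "Suc z" ?y ?S] False True by simp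
      ultimately show ?thesis using D[of ?y] R1 by simp
    qed
    then show ?thesis using True x by (simp add: below_line_ins)
  qed
qed

lemma dominates_card:
  assumes "finite R" "finite S" "dominates R S"
  shows "card S \<le> card R"
proof -
  obtain N where "\<forall>s\<in>S. s < N" using assms(2) finite_nat_set_iff_bounded by blast
  then have "S \<inter> {..<Suc N} = S" by auto
  then have "below S (Suc N) = card S" by (simp add: below_def)
  then show ?thesis
    using assms(3) below_le_card[OF assms(1), of N] unfolding dominates_def by (metis order_trans)
qed

section \<open>Tableaux as lists of columns\<close>

fun line :: "nat set list \<Rightarrow> nat \<Rightarrow> nat set" where
  "line [] c = {}"
| "line (R # Rs) 0 = R"
| "line (R # Rs) (Suc c) = line Rs c"

text \<open>\<open>dominates\<close> between neighbours makes rows strictly increasing; columns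
  increase automatically, being sets.\<close>

fun tab :: "nat set list \<Rightarrow> bool" where
  "tab [] \<longleftrightarrow> True"
| "tab (R # Rs) \<longleftrightarrow> finite R \<and> R \<noteq> {} \<and> dominates R (line Rs 0) \<and> tab Rs"

lemma tab_finite: "tab Rs \<Longrightarrow> \<forall>R\<in>set Rs. finite R"
  by (induction Rs) auto

lemma finite_line: "\<forall>R\<in>set Rs. finite R \<Longrightarrow> finite (line Rs c)"
  by (induction Rs c rule: line.induct) auto

lemma tab_line_card: "tab Rs \<Longrightarrow> card (line Rs (Suc c)) \<le> card (line Rs c)"
proof (induction Rs c rule: line.induct)
  case (2 R Rs)
  then show ?case using dominates_card[of R "line Rs 0"] finite_line[OF tab_finite] by simp
qed simp_all

lemma tab_line_empty: "tab Rs \<Longrightarrow> line Rs c = {} \<longleftrightarrow> length Rs \<le> c"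
  by (induction Rs c rule: line.induct) auto

lemma line_ins_empty [simp]: "line_ins y {} = {y}"
  by (simp add: line_ins_def)

lemma line_ins_0: "line (ins y Rs) 0 = line_ins y (line Rs 0)"
  by (cases Rs) simp_all

lemma ok_ins_0: "ok_ins y Rs \<Longrightarrow> ok y (line Rs 0)"
  by (cases Rs) simp_all

lemma tab_ins: "tab Rs \<Longrightarrow> ok_ins x Rs \<Longrightarrow> tab (ins x Rs)"
proof (induction x Rs rule: ins.induct)
  case (1 x)
  then show ?case by (simp add: dominates_def below_def)
next
  case (2 x R Rs)
  have ne: "line_ins x R \<noteq> {}" by (simp add: line_ins_def)
  show ?case
  proof (cases "bumps x R")
    case True
    then show ?thesis using 2 ne dominates_ins[of R "line Rs 0" x] ok_ins_0
      by (simp add: line_ins_0)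
  next
    case False
    then have "R \<subseteq> line_ins x R" by (auto simp: line_ins_def)
    then have "dominates (line_ins x R) (line Rs 0)"
      using 2(2) unfolding dominates_def by (meson below_subset order_trans tab.simps(2) dominates_def)
    then show ?thesis using 2 ne False by simp
  qed
qed

lemma card_line_ins:
  assumes "finite R" "ok x R"
  shows "card (line_ins x R) = card R + of_bool (\<not> bumps x R)"
  using assms(2)
proof (cases rule: line_cases)
  case (replace y)
  then have "card (line_ins x R) = Suc (card (R - {y}))" using assms(1) by simp
  then show ?thesis using card_Suc_Diff1[OF assms(1) replace(4)] replace(2) by simp
qed (use assms(1) in auto)

lemma card_line_tab_ins:
  assumes "\<forall>R\<in>set Rs. finite R" "ok_ins x Rs"
  shows "card (line (ins x Rs) c) = card (line Rs c) + of_bool (c = pos x Rs)"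
  using assms
proof (induction x Rs arbitrary: c rule: ins.induct)
  case (1 x)
  then show ?case by (cases c) auto
next
  case (2 x R Rs)
  then show ?case by (cases c) (auto simp: card_line_ins)
qed

lemma P_tab_tab: "reduced \<rho> \<Longrightarrow> tab (P_tab \<rho>)"
proof (induction \<rho>)
  case (Cons x \<rho>)
  then show ?case using tab_ins[OF _ P_tab_ok_ins] reduced_suffix[of "[x]" \<rho>] by simp
qed simp

lemma count_Q_word:
  "reduced \<rho> \<Longrightarrow> count_list (Q_word \<rho>) c = card (line (P_tab \<rho>) c)"
proof (induction \<rho>)
  case (Cons x \<rho>)
  have "reduced \<rho>" using Cons.prems reduced_suffix[of "[x]" \<rho>] by simp
  then show ?case
    using Cons.IH card_line_tab_ins[OF finite_P_tab P_tab_ok_ins[OF Cons.prems]] by simp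
qed simp

text \<open>The ballot condition is on suffixes because the latest letter stands first.\<close>

fun lattice_word :: "nat list \<Rightarrow> bool" where
  "lattice_word [] \<longleftrightarrow> True"
| "lattice_word (j # q) \<longleftrightarrow>
     (\<forall>c. count_list (j # q) (Suc c) \<le> count_list (j # q) c) \<and> lattice_word q"

lemma Q_word_lattice: "reduced \<rho> \<Longrightarrow> lattice_word (Q_word \<rho>)"
proof (induction \<rho>)
  case (Cons x \<rho>)
  have "lattice_word (Q_word \<rho>)" using Cons reduced_suffix[of "[x]" \<rho>] by simp
  moreover have "count_list (Q_word (x # \<rho>)) (Suc c) \<le> count_list (Q_word (x # \<rho>)) c" for c
    using tab_line_card[OF P_tab_tab[OF Cons.prems]] by (simp only: count_Q_word[OF Cons.prems])
  ultimately show ?case by (simp del: count_list.simps)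
qed simp

lemma length_Q_word [simp]: "length (Q_word \<rho>) = length \<rho>"
  by (induction \<rho>) simp_all

section \<open>Undoing an insertion\<close>

lemma line_inj_append:
  assumes "ok x R" "\<not> bumps x R" "ok x' R'" "\<not> bumps x' R'" "line_ins x R = line_ins x' R'"
  shows "x = x' \<and> R = R'"
proof -
  have x: "x \<notin> R" "x' \<notin> R'" using assms by auto
  have eq: "insert x R = insert x' R'" using assms by (simp add: line_ins_def)
  have "x \<le> x'" "x' \<le> x" using eq assms(2,4) by (metis insert_iff not_le order_refl)+
  then show ?thesis using eq x insert_ident[of x R R'] by simp
qed

lemma bump_below:
  assumes "ok x R" "bumps x R" "r \<in> line_ins x R" "r < bump x R"
  shows "r \<le> x"
  using assms bump_le[of r R x] by (auto simp: line_ins_def not_le[symmetric] split: if_splits)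

text \<open>\<open>x\<close> is the largest entry of the new column below the bumped value, and
  whether that value is still present tells the exceptional case from a replacement.\<close>

lemma line_inj_bump:
  assumes x: "ok x R" "bumps x R" and x': "ok x' R'" "bumps x' R'"
    and eq: "line_ins x R = line_ins x' R'" "bump x R = bump x' R'"
  shows "x = x' \<and> R = R'"
proof -
  have mem: "x \<in> line_ins x R" "x' \<in> line_ins x' R'" by (simp_all add: line_ins_def)
  have "x \<le> x'" using bump_below[OF x', of x] mem(1) bump_in[OF x(2)] eq by simp
  moreover have "x' \<le> x" using bump_below[OF x, of x'] mem(2) bump_in[OF x'(2)] eq by simp
  ultimately have xx: "x = x'" by simp
  have *: "R = (if bump x R \<in> line_ins x R then line_ins x R else insert (bump x R) (line_ins x R - {x}))"
    if "ok x R" "bumps x R" for x R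
    using that(1)
  proof (cases rule: line_cases)
    case append
    then show ?thesis using that(2) by blast
  next
    case (replace y)
    then show ?thesis by auto
  next
    case keep
    then show ?thesis by simp
  qed
  show ?thesis using *[OF x] *[OF x'] xx eq by metis
qed

text \<open>\<open>pos\<close> tells how many columns were bumped through. The remaining columns
  give back the bumped letter, which is what restoring the first column requires.\<close>

lemma ins_inj:
  assumes "tab Rs" "tab Rs'" "ok_ins x Rs" "ok_ins x' Rs'" "ins x Rs = ins x' Rs'"
    "pos x Rs = pos x' Rs'"
  shows "x = x' \<and> Rs = Rs'"
  using assms
proof (induction x Rs arbitrary: x' Rs' rule: ins.induct)
  case (1 x)
  show ?case
  proof (cases Rs')
    case Nil
    then show ?thesis using 1 by simp
  next
    case (Cons R' Ts')
    have nb: "\<not> bumps x' R'" using 1(6) Cons by (auto split: if_splits)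
    then have "x = x' \<and> {} = R'" using 1 Cons by (intro line_inj_append) auto
    then show ?thesis using 1(2) Cons by simp
  qed
next
  case (2 x R Rs)
  show ?case
  proof (cases Rs')
    case Nil
    have nb: "\<not> bumps x R" using 2(7) Nil by (auto split: if_splits)
    then have "x = x' \<and> R = {}" using 2 Nil by (intro line_inj_append) auto
    then show ?thesis using 2(2) by simp
  next
    case (Cons R' Ts')
    have b: "bumps x R \<longleftrightarrow> bumps x' R'" using 2(7) Cons by (auto split: if_splits)
    show ?thesis
    proof (cases "bumps x R")
      case True
      have *: "bump x R = bump x' R' \<and> Rs = Ts'"
        using 2(2-7) Cons True b by (intro 2(1)) simp_all
      moreover have "x = x' \<and> R = R'"
        using 2(2-7) Cons True b * by (intro line_inj_bump) simp_all
      ultimately show ?thesis using Cons by simp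
    next
      case False
      have "x = x' \<and> R = R'" using 2(2-7) Cons False b by (intro line_inj_append) simp_all
      then show ?thesis using 2(6) Cons False b by simp
    qed
  qed
qed

lemma P_tab_Q_word_inj:
  assumes "reduced \<rho>" "reduced \<sigma>" "P_tab \<rho> = P_tab \<sigma>" "Q_word \<rho> = Q_word \<sigma>"
  shows "\<rho> = \<sigma>"
  using assms
proof (induction \<rho> arbitrary: \<sigma>)
  case Nil
  then show ?case by (metis Q_word.simps(1) length_0_conv length_Q_word)
next
  case (Cons x \<rho>)
  obtain x' \<sigma>' where \<sigma>: "\<sigma> = x' # \<sigma>'" using Cons.prems(4) by (cases \<sigma>) auto
  have red: "reduced \<rho>" "reduced \<sigma>'"
    using Cons.prems(1,2) \<sigma> reduced_suffix[of "[x]" \<rho>] reduced_suffix[of "[x']" \<sigma>'] by simp_all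
  have "x = x' \<and> P_tab \<rho> = P_tab \<sigma>'"
    using Cons.prems \<sigma> red P_tab_tab P_tab_ok_ins by (intro ins_inj) auto
  then show ?case using Cons.IH[OF red] Cons.prems \<sigma> by simp
qed

text \<open>The letter must be the largest entry below \<open>y\<close>. If \<open>y\<close> is
  present, the last hypothesis forces it to be \<open>y - 1\<close> and the bump was exceptional;
  otherwise it is exchanged for \<open>y\<close>.\<close>

lemma line_ins_reverse:
  assumes fin: "finite R'" and r: "r \<in> R'" "r < y" and y: "y \<in> R' \<longrightarrow> y - 1 \<in> R'"
  obtains x R where "finite R" "R \<noteq> {}" "ok x R" "bumps x R" "bump x R = y" "line_ins x R = R'"
proof -
  define x where "x = Max {r \<in> R'. r < y}"
  have "x \<in> {r \<in> R'. r < y}" unfolding x_def using fin r by (intro Max_in) auto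
  then have x: "x \<in> R'" "x < y" by auto
  have max: "r \<le> x" if "r \<in> R'" "r < y" for r
    unfolding x_def using fin that by (intro Max_ge) auto
  show ?thesis
  proof (cases "y \<in> R'")
    case True
    then have "y - 1 \<le> x" using y x by (intro max) auto
    then have yx: "y = Suc x" using x by simp
    show ?thesis
      using True x fin yx by (intro that[of R' x]) (auto intro!: bump_eqI simp: line_ins_keep)
  next
    case False
    define R where "R = insert y (R' - {x})"
    have "x \<notin> R" "y \<in> R" using x by (auto simp: R_def)
    moreover have "y \<le> r" if "r \<in> R" "x < r" for r
      using that max[of r] by (auto simp: R_def not_le[symmetric])
    ultimately have "line_ins x R = insert x (R - {y})" "bumps x R" "bump x R = y"
      using line_ins_replace[of x R y] x by auto
    moreover have "insert x (R - {y}) = R'" using False x by (auto simp: R_def)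
    ultimately show ?thesis using \<open>x \<notin> R\<close> \<open>y \<in> R\<close> fin by (intro that[of R x]) (auto simp: R_def)
  qed
qed

text \<open>The corner of column \<open>j\<close> is vacated. Undoing starts in the columns to the
  right, which return a letter \<open>y\<close> for the first column; reducedness of the reading
  word supplies what the exceptional case needs.\<close>

lemma ins_surj:
  assumes "tab T" "reduced (reading T)" "card (line T (Suc j)) < card (line T j)"
  shows "\<exists>x Rs. tab Rs \<and> ok_ins x Rs \<and> ins x Rs = T \<and> pos x Rs = j"
  using assms
proof (induction T arbitrary: j)
  case Nil
  then show ?case by simp
next
  case (Cons R' T)
  have fin: "finite R'" "R' \<noteq> {}" using Cons.prems(1) by auto
  have dom: "dominates R' (line T 0)" and tabT: "tab T" using Cons.prems(1) by auto
  show ?case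
  proof (cases j)
    case 0
    \<comment> \<open>The top cell is removed; the strict inequality of column lengths keeps the
      next column dominated.\<close>
    define x where "x = Max R'"
    define R where "R = R' - {x}"
    have x: "x \<in> R'" "\<And>r. r \<in> R' \<Longrightarrow> r \<le> x" using fin by (simp_all add: x_def)
    have ins: "x \<notin> R" "\<not> bumps x R" "insert x R = R'"
      using x by (auto simp: R_def not_less)
    then have lR: "line_ins x R = R'" by (simp add: line_ins_def)
    have cR: "card R' = Suc (card R)" using card_Suc_Diff1[OF fin(1) x(1)] by (simp only: R_def)
    then have le: "card (line T 0) \<le> card R" using Cons.prems(3) 0 by simp
    have finT: "finite (line T 0)" using finite_line[OF tab_finite[OF tabT]] .
    show ?thesis
    proof (cases "R = {}")
      case True
      then have "line T 0 = {}" using le finT by simp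
      then have "T = []" using tab_line_empty[OF tabT, of 0] by simp
      moreover have "R' = {x}" using True ins by simp
      ultimately show ?thesis using 0 by (intro exI[of _ x] exI[of _ "[]"]) simp
    next
      case False
      have "below (line T 0) (Suc z) \<le> below R z" for z
      proof (cases "x < z")
        case True
        then have "below R z = card R"
          using x(2) unfolding below_def R_def by (intro arg_cong[where f = card]) fastforce
        then show ?thesis using le below_le_card[OF finT, of "Suc z"] by simp
      next
        case False
        then have "below R z = below R' z" using below_insert[of x R z] ins by simp
        then show ?thesis using dom by (simp add: dominates_def)
      qed
      then have "tab (R # T)" using False fin(1) tabT by (simp add: dominates_def R_def)
      then show ?thesis using 0 ins lR by (intro exI[of _ x] exI[of _ "R # T"]) simp
    qed
  next
    case (Suc j')
    have "reduced (reading T)" using Cons.prems(2) reduced_suffix[of "desc R'"] by simp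
    then obtain y Rs where y: "tab Rs" "ok_ins y Rs" "ins y Rs = T" "pos y Rs = j'"
      using Cons.IH[of j'] Cons.prems(3) tabT Suc by auto
    have T0: "line T 0 = line_ins y (line Rs 0)" using y(3) line_ins_0 by auto
    \<comment> \<open>Since \<open>y\<close> lies in the next column, dominance supplies an entry of
      \<open>R'\<close> below \<open>y\<close>.\<close>
    then have "y \<in> line T 0" by (simp add: line_ins_def)
    then have "0 < below (line T 0) (Suc y)" by (simp add: below_Suc)
    then have "0 < below R' y" using dom unfolding dominates_def by (metis less_le_trans)
    then obtain r where r: "r \<in> R'" "r < y" by (auto simp: below_def card_gt_0_iff)
    have "ck_equiv (desc R' @ y # reading Rs) (desc R' @ reading T)"
      using ck_equiv_context[OF ins_ck[OF tab_finite[OF y(1)] y(2)], of "desc R'" "[]"] y(3) by simp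
    then have "reduced (desc R' @ y # reading Rs)"
      using Cons.prems(2) ck_equiv_reduced by simp
    then have "reduced (desc R' @ [y])" using reduced_prefix[of "desc R' @ [y]"] by simp
    then have "y \<in> R' \<longrightarrow> y - 1 \<in> R'" using reduced_ok_reverse[OF fin(1) _ r] by blast
    from line_ins_reverse[OF fin(1) r this] obtain x R
      where R: "finite R" "R \<noteq> {}" "ok x R" "bumps x R" "bump x R = y" "line_ins x R = R'" .
    have "dominates R (line Rs 0)"
      using dominates_ins_reverse[of x R "line Rs 0"] dom T0 R ok_ins_0[OF y(2)] by simp
    then show ?thesis using R y Suc by (intro exI[of _ x] exI[of _ "R # Rs"]) simp
  qed
qed

text \<open>Letters are recovered from the latest to the earliest. That column \<open>j\<close> has
  a corner follows from the lattice condition on the rest of the word.\<close>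

lemma P_tab_Q_word_surj:
  assumes "lattice_word q" "tab T" "reduced (reading T)" "\<And>c. count_list q c = card (line T c)"
  shows "\<exists>\<sigma>. reduced \<sigma> \<and> P_tab \<sigma> = T \<and> Q_word \<sigma> = q"
  using assms
proof (induction q arbitrary: T)
  case Nil
  have "line T 0 = {}" using Nil(4)[of 0] finite_line[OF tab_finite[OF Nil(2)]] by simp
  then have "T = []" using tab_line_empty[OF Nil(2), of 0] by simp
  moreover have "reduced []" by (simp add: reduced_def)
  ultimately show ?case by (intro exI[of _ "[]"]) simp
next
  case (Cons j q)
  have lat: "count_list q (Suc j) \<le> count_list q j"
  proof (cases q)
    case (Cons j' q')
    then show ?thesis using \<open>lattice_word (j # q)\<close> by (simp del: count_list.simps)
  qed simp
  have "card (line T (Suc j)) < card (line T j)"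
    using lat Cons.prems(4)[of j] Cons.prems(4)[of "Suc j"] by simp
  then obtain x Rs where x: "tab Rs" "ok_ins x Rs" "ins x Rs = T" "pos x Rs = j"
    using ins_surj Cons.prems by blast
  have ck: "ck_equiv (x # reading Rs) (reading T)"
    using ins_ck[OF tab_finite[OF x(1)] x(2)] x(3) by simp
  then have red: "reduced (x # reading Rs)" using Cons.prems(3) ck_equiv_reduced by blast
  then have redR: "reduced (reading Rs)" using reduced_suffix[of "[x]"] by simp
  have "count_list q c = card (line Rs c)" for c
    using Cons.prems(4)[of c] card_line_tab_ins[OF tab_finite[OF x(1)] x(2), of c] x(3,4)
    by (auto split: if_splits)
  then obtain \<sigma> where \<sigma>: "reduced \<sigma>" "P_tab \<sigma> = Rs" "Q_word \<sigma> = q"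
    using Cons.IH[OF _ x(1) redR] Cons.prems(1) by auto
  have "ck_equiv (x # \<sigma>) (x # reading Rs)"
    using ck_equiv_context[OF P_tab_ck_reading[OF \<sigma>(1)], of "[x]" "[]"] \<sigma>(2) by simp
  then have "reduced (x # \<sigma>)" using red ck_equiv_reduced by blast
  then show ?case using \<sigma> x by (intro exI[of _ "x # \<sigma>"]) simp
qed

lemma Q_word_bij:
  assumes "reduced \<rho>"
  shows "bij_betw Q_word {\<sigma>. ck_equiv \<rho> \<sigma>}
    {q. lattice_word q \<and> (\<forall>c. count_list q c = card (line (P_tab \<rho>) c))}"
proof (rule bij_betw_imageI)
  show "inj_on Q_word {\<sigma>. ck_equiv \<rho> \<sigma>}"
    using P_tab_Q_word_inj by (auto simp: inj_on_def ck_equiv_iff_P_tab[OF assms])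
  have "reduced (reading (P_tab \<rho>))" using P_tab_ck_reading[OF assms] assms ck_equiv_reduced by blast
  then have surj: "\<exists>\<sigma>. reduced \<sigma> \<and> P_tab \<sigma> = P_tab \<rho> \<and> Q_word \<sigma> = q"
    if "lattice_word q" "\<forall>c. count_list q c = card (line (P_tab \<rho>) c)" for q
    using P_tab_Q_word_surj[of q "P_tab \<rho>"] P_tab_tab[OF assms] that by blast
  show "Q_word ` {\<sigma>. ck_equiv \<rho> \<sigma>} =
      {q. lattice_word q \<and> (\<forall>c. count_list q c = card (line (P_tab \<rho>) c))}"
    using surj by (auto simp: ck_equiv_iff_P_tab[OF assms] Q_word_lattice count_Q_word image_iff)
qed

section \<open>Recorded columns of consecutive letters\<close>

lemma pos_ins_less: "ok_ins y Rs \<Longrightarrow> x < y \<Longrightarrow> pos y Rs < pos x (ins y Rs)"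
proof (induction y Rs arbitrary: x rule: ins.induct)
  case (2 y R Rs)
  then show ?case using bump_after_greater[of x y R] by simp
qed simp

lemma pos_ins_le: "ok_ins y Rs \<Longrightarrow> y < x \<Longrightarrow> pos x (ins y Rs) \<le> pos y Rs"
proof (induction y Rs arbitrary: x rule: ins.induct)
  case (2 y R Rs)
  then show ?case using bump_after_less[of y x R] by simp
qed simp

text \<open>A repeated letter would cancel, so the letters differ and the two comparisons of
  \<open>pos\<close> cover all cases.\<close>

lemma Q_word_descent:
  assumes "reduced (x # y # \<rho>)"
  shows "x < y \<longleftrightarrow> pos y (P_tab \<rho>) < pos x (ins y (P_tab \<rho>))"
proof -
  have "x \<noteq> y" using assms not_reduced_commuting[of "[]" x "[]" \<rho>] by auto
  moreover have "ok_ins y (P_tab \<rho>)"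
    using P_tab_ok_ins reduced_suffix[of "[x]" "y # \<rho>"] assms by simp
  ultimately show ?thesis
    using pos_ins_less[of y "P_tab \<rho>" x] pos_ins_le[of y "P_tab \<rho>" x] by (cases "x < y") auto
qed

section \<open>Descent compositions\<close>

abbreviation run_lengths :: "('a \<Rightarrow> 'a \<Rightarrow> bool) \<Rightarrow> 'a list \<Rightarrow> nat list" where
  "run_lengths P xs \<equiv> map length (runs_by P xs)"

lemma runs_by_nonempty: "runs_by P (x # xs) \<noteq> []"
  by (cases xs) (simp_all add: Let_def)

lemma run_lengths_Cons:
  "run_lengths P (x # y # zs) =
     (if P x y then Suc (hd (run_lengths P (y # zs))) # tl (run_lengths P (y # zs))
      else 1 # run_lengths P (y # zs))"
  using runs_by_nonempty[of P y zs] by (simp add: Let_def hd_map map_tl)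

lemma run_lengths_snoc:
  "run_lengths P (xs @ [a, b]) =
     (if P a b then butlast (run_lengths P (xs @ [a])) @ [Suc (last (run_lengths P (xs @ [a])))]
      else run_lengths P (xs @ [a]) @ [1])"
proof (induction xs)
  case Nil
  then show ?case by simp
next
  case (Cons x xs)
  obtain h t where h: "xs @ [a] = h # t" by (cases xs) auto
  then have hb: "xs @ [a, b] = h # t @ [b]" by (metis append.assoc append_Cons append_Nil)
  have ne: "run_lengths P (h # t) \<noteq> []" using runs_by_nonempty[of P h t] by simp
  show ?case
    using Cons.IH ne unfolding append_Cons h hb run_lengths_Cons
    by (cases "run_lengths P (h # t)") (auto simp del: runs_by.simps)
qed

lemma run_lengths_rev: "run_lengths P (rev xs) = rev (run_lengths (\<lambda>a b. P b a) xs)"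
proof (induction "\<lambda>a b. P b a" xs rule: runs_by.induct)
  case (3 x y zs)
  have ne: "run_lengths (\<lambda>a b. P b a) (y # zs) \<noteq> []" using runs_by_nonempty[of _ y zs] by simp
  have "run_lengths P (rev (x # y # zs)) = run_lengths P (rev zs @ [y, x])" by simp
  then show ?case
    using 3 ne unfolding run_lengths_snoc run_lengths_Cons
    by (simp add: butlast_rev last_rev del: runs_by.simps)
qed simp_all

text \<open>An ascent of the word is a descent of \<open>Q_word\<close>; reversal restores
  increasing runs, in the order used by \<open>word_Des\<close>.\<close>

lemma word_Des_Q_word:
  assumes "reduced \<rho>"
  shows "word_Des \<rho> = run_lengths (<) (rev (Q_word \<rho>))"
proof -
  have "run_lengths (<) \<rho> = run_lengths (\<lambda>a b. b < a) (Q_word \<rho>)"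
    using assms
  proof (induction "(<) :: nat \<Rightarrow> nat \<Rightarrow> bool" \<rho> rule: runs_by.induct)
    case (3 x y zs)
    have "run_lengths (<) (y # zs) = run_lengths (\<lambda>a b. b < a) (Q_word (y # zs))"
      using 3 reduced_suffix[of "[x]" "y # zs"] by simp
    then show ?case
      using Q_word_descent[OF 3(2)] unfolding run_lengths_Cons Q_word.simps P_tab_simps
      by (simp del: runs_by.simps)
  qed simp_all
  then show ?thesis unfolding run_lengths_rev word_Des_def rev_map[symmetric] by simp
qed

lemma concat_runs_by: "concat (runs_by P xs) = xs"
proof (induction P xs rule: runs_by.induct)
  case (3 P x y zs)
  then show ?case using runs_by_nonempty[of P y zs] by (cases "runs_by P (y # zs)") (auto simp: Let_def)
qed simp_all

lemma runs_by_hd: "hd (hd (runs_by P (x # xs))) = x \<and> hd (runs_by P (x # xs)) \<noteq> []"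
  by (cases xs) (simp_all add: Let_def)

lemma runs_by_sorted:
  assumes "transp P" "b \<in> set (runs_by P xs)"
  shows "sorted_wrt P b"
  using assms
proof (induction P xs arbitrary: b rule: runs_by.induct)
  case (3 P x y zs)
  let ?rs = "runs_by P (y # zs)"
  have rs: "?rs = hd ?rs # tl ?rs" using runs_by_nonempty[of P y zs] by simp
  then have tl: "set ?rs = insert (hd ?rs) (set (tl ?rs))" by (metis list.simps(15))
  have IH: "sorted_wrt P b" if "b \<in> set ?rs" for b using 3 that by blast
  show ?case
  proof (cases "P x y \<and> b = x # hd ?rs")
    case True
    obtain ys where ys: "hd ?rs = y # ys"
      using runs_by_hd[of P y zs] by (metis list.collapse)
    then have "sorted_wrt P (y # ys)" using IH tl by (metis insertI1)
    then have "sorted_wrt P (x # y # ys)" using True 3(2) by (auto dest: transpD)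
    then show ?thesis using True ys by simp
  next
    case False
    then have "b \<in> set ?rs \<or> b = [x]" using 3(3) tl by (auto simp: Let_def split: if_splits)
    then show ?thesis using IH by auto
  qed
qed simp_all

lemma runs_by_append:
  assumes "b \<noteq> []" "successively P b" "xs = [] \<or> \<not> P (last b) (hd xs)"
  shows "runs_by P (b @ xs) = b # runs_by P xs"
  using assms
proof (induction b rule: induct_list012)
  case (2 x)
  then show ?case by (cases xs) (auto simp: Let_def)
next
  case (3 x y zs)
  then show ?case by (auto simp: Let_def)
qed simp

lemma runs_by_concat_upt:
  "0 \<notin> set ks \<Longrightarrow> runs_by (<) (concat (map (\<lambda>k. [0..<k]) ks)) = map (\<lambda>k. [0..<k]) ks"
proof (induction ks)
  case (Cons k ks)
  define rest where "rest = concat (map (\<lambda>k. [0..<k]) ks)"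
  have "successively (<) [0..<k]" by (simp add: successively_conv_nth)
  moreover have "rest = [] \<or> hd rest = 0"
    using Cons.prems by (cases ks) (auto simp: rest_def hd_append upt_conv_Cons)
  then have "rest = [] \<or> \<not> last [0..<k] < hd rest" by auto
  ultimately have "runs_by (<) ([0..<k] @ rest) = [0..<k] # runs_by (<) rest"
    using Cons.prems by (intro runs_by_append) auto
  then show ?case using Cons by (simp add: rest_def)
qed simp

section \<open>Standard tableaux as lattice words\<close>

definition col_length :: "nat list \<Rightarrow> nat \<Rightarrow> nat" where
  "col_length lam c = card {r. (r, c) \<in> diagram lam}"

text \<open>Its reverse is the counterpart of \<open>Q_word\<close>.\<close>

definition column_word :: "nat list \<Rightarrow> filling \<Rightarrow> nat list" where
  "column_word lam T = map (tab_column lam T) [1..<Suc (sum_list lam)]"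

lemma length_column_word [simp]: "length (column_word lam T) = sum_list lam"
  by (simp add: column_word_def del: upt_Suc)

lemma run_lengths_map: "run_lengths P (map f xs) = run_lengths (\<lambda>a b. P (f a) (f b)) xs"
proof (induction "\<lambda>a b. P (f a) (f b)" xs rule: runs_by.induct)
  case (3 x y zs)
  then show ?case unfolding list.map run_lengths_Cons by (simp del: runs_by.simps)
qed simp_all

lemma tab_Des_column_word: "tab_Des lam T = run_lengths (<) (column_word lam T)"
  unfolding tab_Des_def column_word_def run_lengths_map not_le ..

lemma diagram_down:
  assumes "is_partition lam" "(r, c) \<in> diagram lam" "r' \<le> r" "c' \<le> c"
  shows "(r', c') \<in> diagram lam"
proof -
  have "lam ! r \<le> lam ! r'"
    using assms sorted_wrt_nth_less[of "(\<ge>)" lam r' r]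
    by (cases "r' = r") (auto simp: is_partition_def diagram_def)
  then show ?thesis using assms by (auto simp: diagram_def)
qed

lemma down_closed_lessThan:
  fixes A :: "nat set"
  assumes "finite A" "\<And>a b. a \<in> A \<Longrightarrow> b \<le> a \<Longrightarrow> b \<in> A"
  shows "A = {..<card A}"
proof (cases "A = {}")
  case False
  then have "A = {..Max A}" using assms Max_in by (auto intro: Max_ge)
  then have "A = {..<Suc (Max A)}" by (simp add: lessThan_Suc_atMost)
  then show ?thesis by (metis card_lessThan)
qed simp

lemma diagram_col:
  assumes "is_partition lam"
  shows "(r, c) \<in> diagram lam \<longleftrightarrow> r < col_length lam c"
proof -
  have "finite {r. (r, c) \<in> diagram lam}"
    by (rule finite_subset[of _ "{..<length lam}"]) (auto simp: diagram_def)
  then have "{r. (r, c) \<in> diagram lam} = {..<col_length lam c}"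
    unfolding col_length_def by (rule down_closed_lessThan) (use diagram_down[OF assms] in blast)
  then show ?thesis by auto
qed

lemma card_diagram_rows: "card {(r, c) \<in> diagram lam. r < j} = sum_list (take j lam)"
proof -
  have "{(r, c) \<in> diagram lam. r < j} = (SIGMA r:{..<min j (length lam)}. {..<lam ! r})"
    by (auto simp: diagram_def)
  then have "card {(r, c) \<in> diagram lam. r < j} = (\<Sum>r<min j (length lam). lam ! r)" by simp
  also have "\<dots> = sum_list (take j lam)"
    by (simp add: sum_list_sum_nth atLeast0LessThan min.commute)
  finally show ?thesis .
qed

lemma card_diagram: "card (diagram lam) = sum_list lam"
proof -
  have "{(r, c) \<in> diagram lam. r < length lam} = diagram lam" by (auto simp: diagram_def)
  then show ?thesis using card_diagram_rows[of lam "length lam"] by simp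
qed

lemma tab_column_eq:
  assumes "T \<in> SYT lam" "(r, c) \<in> diagram lam"
  shows "tab_column lam T (T (r, c)) = c"
proof -
  have "inj_on T (diagram lam)" using assms(1) by (auto simp: SYT_def bij_betw_def)
  then show ?thesis using assms(2) by (simp add: tab_column_def)
qed

lemma SYT_column_set:
  assumes "T \<in> SYT lam"
  shows "{i \<in> {1..sum_list lam}. tab_column lam T i = c} = (\<lambda>r. T (r, c)) ` {r. (r, c) \<in> diagram lam}"
proof -
  have "bij_betw T (diagram lam) {1..sum_list lam}" using assms by (simp add: SYT_def)
  then have im: "T ` diagram lam = {1..sum_list lam}" by (simp add: bij_betw_def)
  show ?thesis
  proof (intro set_eqI iffI)
    fix i assume i: "i \<in> {i \<in> {1..sum_list lam}. tab_column lam T i = c}"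
    then obtain r c' where "i = T (r, c')" "(r, c') \<in> diagram lam" using im by fastforce
    then show "i \<in> (\<lambda>r. T (r, c)) ` {r. (r, c) \<in> diagram lam}"
      using i tab_column_eq[OF assms] by auto
  next
    fix i assume "i \<in> (\<lambda>r. T (r, c)) ` {r. (r, c) \<in> diagram lam}"
    then show "i \<in> {i \<in> {1..sum_list lam}. tab_column lam T i = c}"
      using im tab_column_eq[OF assms] by auto
  qed
qed

lemma count_list_map_upt: "count_list (map f [1..<Suc m]) c = card {i \<in> {1..m}. f i = c}"
proof (induction m)
  case (Suc m)
  have "{i \<in> {1..Suc m}. f i = c} = {i \<in> {1..m}. f i = c} \<union> (if f (Suc m) = c then {Suc m} else {})"
    by (auto simp: le_Suc_eq)
  then show ?case using Suc by simp
qed simp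

lemma count_column_word:
  assumes "m \<le> sum_list lam"
  shows "count_list (take m (column_word lam T)) c = card {i \<in> {1..m}. tab_column lam T i = c}"
proof -
  have "take m (column_word lam T) = map (tab_column lam T) [1..<Suc m]"
    using assms by (simp add: column_word_def take_map take_upt del: upt_Suc)
  then show ?thesis by (simp only: count_list_map_upt)
qed

lemma SYT_less_col: "T \<in> SYT lam \<Longrightarrow> (r, c) \<in> diagram lam \<Longrightarrow> (r', c) \<in> diagram lam \<Longrightarrow> r < r' \<Longrightarrow>
    T (r, c) < T (r', c)"
  by (simp add: SYT_def)

lemma SYT_less_row: "T \<in> SYT lam \<Longrightarrow> (r, c) \<in> diagram lam \<Longrightarrow> (r, c') \<in> diagram lam \<Longrightarrow> c < c' \<Longrightarrow>
    T (r, c) < T (r, c')"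
  by (simp add: SYT_def)

lemma lattice_word_rev:
  "lattice_word (rev w) \<longleftrightarrow> (\<forall>m\<le>length w. \<forall>c. count_list (take m w) (Suc c) \<le> count_list (take m w) c)"
proof (induction w rule: rev_induct)
  case (snoc a w)
  have "count_list (a # rev w) c = count_list (w @ [a]) c" for c by simp
  then show ?case using snoc by (auto simp: le_Suc_eq simp del: count_list.simps)
qed simp

text \<open>Rows increase, so each entry up to \<open>m\<close> in column \<open>Suc c\<close> has
  another one directly to its left.\<close>

lemma column_word_lattice:
  assumes part: "is_partition lam" and T: "T \<in> SYT lam"
  shows "lattice_word (rev (column_word lam T))"
  unfolding lattice_word_rev
proof (intro allI impI)
  fix m c assume "m \<le> length (column_word lam T)"
  then have m: "m \<le> sum_list lam" by simp
  let ?I = "\<lambda>c. {i \<in> {1..m}. tab_column lam T i = c}"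
  have I: "?I c = (\<lambda>r. T (r, c)) ` {r. (r, c) \<in> diagram lam \<and> T (r, c) \<le> m}" for c
  proof -
    have "?I c = {i \<in> {1..sum_list lam}. tab_column lam T i = c} \<inter> {..m}" using m by auto
    then show ?thesis unfolding SYT_column_set[OF T] by auto
  qed
  have inj: "inj_on (\<lambda>r. T (r, c)) {r. (r, c) \<in> diagram lam \<and> T (r, c) \<le> m}" for c
    using SYT_less_col[OF T] by (auto simp: inj_on_def) (metis less_irrefl linorder_neqE_nat)
  have fin: "finite {r. (r, c) \<in> diagram lam \<and> T (r, c) \<le> m}" for c
    by (rule finite_subset[of _ "{..<length lam}"]) (auto simp: diagram_def)
  have "{r. (r, Suc c) \<in> diagram lam \<and> T (r, Suc c) \<le> m} \<subseteq> {r. (r, c) \<in> diagram lam \<and> T (r, c) \<le> m}"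
  proof clarify
    fix r assume r: "(r, Suc c) \<in> diagram lam" "T (r, Suc c) \<le> m"
    then have "(r, c) \<in> diagram lam" using diagram_down[OF part] by (meson le_refl le_SucI)
    then show "(r, c) \<in> diagram lam \<and> T (r, c) \<le> m" using r SYT_less_row[OF T, of r c "Suc c"] by simp
  qed
  from card_mono[OF fin this]
  show "count_list (take m (column_word lam T)) (Suc c) \<le> count_list (take m (column_word lam T)) c"
    unfolding count_column_word[OF m] I card_image[OF inj] .
qed

lemma column_word_count:
  assumes T: "T \<in> SYT lam"
  shows "count_list (column_word lam T) c = col_length lam c"
proof -
  have inj: "inj_on (\<lambda>r. T (r, c)) {r. (r, c) \<in> diagram lam}"
    using SYT_less_col[OF T] by (auto simp: inj_on_def) (metis less_irrefl linorder_neqE_nat)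
  have "count_list (column_word lam T) c = card {i \<in> {1..sum_list lam}. tab_column lam T i = c}"
    using count_column_word[of "sum_list lam" lam T c] by simp
  then show ?thesis unfolding SYT_column_set[OF T] card_image[OF inj] col_length_def .
qed

lemma sorted_list_of_set_eqI:
  assumes "sorted_wrt (<) xs" "set xs = (S :: nat set)"
  shows "sorted_list_of_set S = xs"
proof -
  have "distinct xs" using assms(1) by (simp add: strict_sorted_iff)
  then show ?thesis using assms sorted_list_of_set_unique[of S xs] distinct_card[of xs] by auto
qed

text \<open>An increasing column is determined by its set of entries, which the column word
  knows.\<close>

lemma SYT_eq_nth:
  assumes part: "is_partition lam" and T: "T \<in> SYT lam" and rc: "(r, c) \<in> diagram lam"
  shows "T (r, c) = sorted_list_of_set {i \<in> {1..sum_list lam}. tab_column lam T i = c} ! r"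
proof -
  have "sorted_list_of_set {i \<in> {1..sum_list lam}. tab_column lam T i = c} =
      map (\<lambda>r. T (r, c)) [0..<col_length lam c]"
  proof (rule sorted_list_of_set_eqI)
    show "sorted_wrt (<) (map (\<lambda>r. T (r, c)) [0..<col_length lam c])"
      using SYT_less_col[OF T] by (simp add: sorted_wrt_iff_nth_less diagram_col[OF part])
    show "set (map (\<lambda>r. T (r, c)) [0..<col_length lam c]) = {i \<in> {1..sum_list lam}. tab_column lam T i = c}"
      unfolding SYT_column_set[OF T] by (auto simp: diagram_col[OF part])
  qed
  then show ?thesis using rc by (simp add: diagram_col[OF part])
qed

lemma column_word_inj:
  assumes part: "is_partition lam"
  shows "inj_on (column_word lam) (SYT lam)"
proof (rule inj_onI)
  fix T T' assume T: "T \<in> SYT lam" "T' \<in> SYT lam" and eq: "column_word lam T = column_word lam T'"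
  have col: "tab_column lam T i = tab_column lam T' i" if "i \<in> {1..sum_list lam}" for i
    using eq that by (simp add: column_word_def del: upt_Suc)
  show "T = T'"
  proof (rule extensionalityI[of _ "diagram lam"])
    fix x assume "x \<in> diagram lam"
    then obtain r c where x: "x = (r, c)" "(r, c) \<in> diagram lam" by (cases x) auto
    have "{i \<in> {1..sum_list lam}. tab_column lam T i = c} = {i \<in> {1..sum_list lam}. tab_column lam T' i = c}"
      using col by auto
    then show "T x = T' x" using SYT_eq_nth[OF part T(1)] SYT_eq_nth[OF part T(2)] x by simp
  qed (use T in \<open>auto simp: SYT_def\<close>)
qed

lemma sorted_nth_le:
  fixes S :: "nat set"
  assumes "finite S" "r < card (S \<inter> {..i})"
  shows "sorted_list_of_set S ! r \<le> i"
proof (rule ccontr)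
  let ?s = "sorted_list_of_set S"
  assume gt: "\<not> ?s ! r \<le> i"
  have "S \<inter> {..i} \<subseteq> (\<lambda>j. ?s ! j) ` {..<r}"
  proof
    fix x assume x: "x \<in> S \<inter> {..i}"
    then obtain j where j: "j < length ?s" "?s ! j = x" using assms(1) by (metis IntD1 in_set_conv_nth set_sorted_list_of_set)
    have "j < r"
    proof (rule ccontr)
      assume "\<not> j < r"
      then have "?s ! r \<le> ?s ! j" using j by (intro sorted_nth_mono) auto
      then show False using gt x j by auto
    qed
    then show "x \<in> (\<lambda>j. ?s ! j) ` {..<r}" using j by auto
  qed
  then have "card (S \<inter> {..i}) \<le> r" using surj_card_le[of "{..<r}"] by fastforce
  then show False using assms(2) by simp
qed

lemma card_sorted_nth:
  fixes S :: "nat set"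
  assumes "finite S" "r < card S"
  shows "r < card (S \<inter> {..sorted_list_of_set S ! r})"
proof -
  let ?s = "sorted_list_of_set S"
  have len: "length ?s = card S" by simp
  have "(\<lambda>j. ?s ! j) ` {..r} \<subseteq> S \<inter> {..?s ! r}"
  proof clarify
    fix j assume "j \<le> r"
    moreover from this have "?s ! j \<in> S" using assms len by (metis le_less_trans nth_mem set_sorted_list_of_set)
    ultimately show "?s ! j \<in> S \<inter> {..?s ! r}"
      using assms len by (auto intro!: sorted_nth_mono)
  qed
  moreover have "inj_on (\<lambda>j. ?s ! j) {..r}"
    using assms len by (auto simp: inj_on_def nth_eq_iff_index_eq)
  ultimately have "card {..r} \<le> card (S \<inter> {..?s ! r})" using assms(1) by (intro card_inj_on_le) auto
  then show ?thesis by simp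
qed

lemma column_word_surj:
  assumes part: "is_partition lam" and lat: "lattice_word (rev w)"
    and count: "\<And>c. count_list w c = col_length lam c"
  shows "\<exists>T\<in>SYT lam. column_word lam T = w"
proof -
  define N where "N = length w"
  define I where "I = (\<lambda>c. {i \<in> {1..N}. w ! (i - 1) = c})"
  \<comment> \<open>\<open>I c\<close> holds the positions, counted from 1, of the letter
    \<open>c\<close> in \<open>w\<close>; they are listed up column \<open>c\<close>.\<close>
  define T where "T = restrict (\<lambda>(r, c). sorted_list_of_set (I c) ! r) (diagram lam)"
  have finI: "finite (I c)" for c by (simp add: I_def)
  have w: "w = map (\<lambda>i. w ! (i - 1)) [1..<Suc N]"
    by (rule nth_equalityI) (simp_all add: N_def del: upt_Suc)
  have countI: "count_list (take m w) c = card (I c \<inter> {..m})" if "m \<le> N" for m c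
  proof -
    have "take m w = map (\<lambda>i. w ! (i - 1)) [1..<Suc m]"
      using that by (subst w) (simp add: take_map take_upt del: upt_Suc)
    moreover have "{i \<in> {1..m}. w ! (i - 1) = c} = I c \<inter> {..m}" using that by (auto simp: I_def)
    ultimately show ?thesis by (simp only: count_list_map_upt)
  qed
  have cardI: "card (I c) = col_length lam c" for c
  proof -
    have "I c \<inter> {..N} = I c" by (auto simp: I_def)
    then show ?thesis using countI[of N c] count[of c] by (simp add: N_def)
  qed
  have d: "(r, c) \<in> diagram lam \<longleftrightarrow> r < card (I c)" for r c
    by (simp add: diagram_col[OF part] cardI)
  have T: "T (r, c) = sorted_list_of_set (I c) ! r" if "r < card (I c)" for r c
    using that by (simp add: T_def d)
  have TI: "T (r, c) \<in> I c" if "r < card (I c)" for r c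
    using T[OF that] that finI by (metis length_sorted_list_of_set nth_mem set_sorted_list_of_set)
  have inj: "inj_on T (diagram lam)"
  proof (rule inj_onI)
    fix x y assume xy: "x \<in> diagram lam" "y \<in> diagram lam" "T x = T y"
    obtain r c r' c' where rc: "x = (r, c)" "y = (r', c')" by fastforce
    then have lt: "r < card (I c)" "r' < card (I c')" using xy d by auto
    then have "T x \<in> I c \<inter> I c'" using TI rc xy(3) by (metis IntI)
    then have c: "c = c'" by (auto simp: I_def)
    then have "sorted_list_of_set (I c) ! r = sorted_list_of_set (I c) ! r'"
      using T lt rc xy(3) by metis
    then have "r = r'" using lt c by (simp add: nth_eq_iff_index_eq)
    then show "x = y" using rc c by simp
  qed
  have "T ` diagram lam = {1..N}"
  proof (intro set_eqI iffI)
    fix i assume "i \<in> T ` diagram lam"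
    then obtain r c where "i = T (r, c)" "r < card (I c)" using d by auto
    then have "i \<in> I c" using TI by simp
    then show "i \<in> {1..N}" by (simp add: I_def)
  next
    fix i assume i: "i \<in> {1..N}"
    define c where "c = w ! (i - 1)"
    have "i \<in> I c" using i by (simp add: I_def c_def)
    then obtain r where r: "r < length (sorted_list_of_set (I c))" "sorted_list_of_set (I c) ! r = i"
      using finI by (metis in_set_conv_nth set_sorted_list_of_set)
    then have "i = T (r, c)" "(r, c) \<in> diagram lam" using T d by auto
    then show "i \<in> T ` diagram lam" by blast
  qed
  then have bij: "bij_betw T (diagram lam) {1..N}" using inj by (simp add: bij_betw_def)
  then have N: "N = sum_list lam" using bij_betw_same_card card_diagram by fastforce
  have col: "T (r, c) < T (r', c)" if "r < r'" "r' < card (I c)" for r r' c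
    using that T sorted_wrt_nth_less[of "(<)" "sorted_list_of_set (I c)" r r'] by simp
  \<comment> \<open>The prefix of \<open>w\<close> ending at position \<open>T (r, Suc c)\<close>
    has more than \<open>r\<close> letters \<open>Suc c\<close>, hence by the lattice condition more
    than \<open>r\<close> letters \<open>c\<close>.\<close>
  have row1: "T (r, c) < T (r, Suc c)" if r: "r < card (I (Suc c))" for r c
  proof -
    let ?i = "T (r, Suc c)"
    have i: "?i \<in> I (Suc c)" using TI[OF r] .
    then have iN: "?i \<le> N" by (simp add: I_def)
    have "r < card (I (Suc c) \<inter> {..?i})" using card_sorted_nth[OF finI r] T[OF r] by simp
    also have "\<dots> \<le> card (I c \<inter> {..?i})"
      using lat iN countI[OF iN] unfolding lattice_word_rev N_def by metis
    finally have *: "r < card (I c \<inter> {..?i})" .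
    also have "\<dots> \<le> card (I c)" using finI by (intro card_mono) auto
    finally have r': "r < card (I c)" .
    have "T (r, c) \<le> ?i" using sorted_nth_le[OF finI *] T[OF r'] by simp
    moreover have "T (r, c) \<noteq> ?i" using TI[OF r'] i by (auto simp: I_def)
    ultimately show ?thesis by simp
  qed
  have row: "T (r, c) < T (r, c')" if "c < c'" "(r, c') \<in> diagram lam" for r c c'
    using that
  proof (induction c')
    case (Suc c')
    have *: "T (r, c') < T (r, Suc c')" using Suc.prems row1 d by simp
    show ?case
    proof (cases "c = c'")
      case False
      have "(r, c') \<in> diagram lam" using diagram_down[OF part Suc.prems(2)] by simp
      then show ?thesis using Suc False * by simp
    qed (use * in simp)
  qed simp
  have ext: "T \<in> extensional (diagram lam)" by (simp add: T_def)
  have SYT: "T \<in> SYT lam"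
    unfolding SYT_def using ext bij row col N d by auto
  have "column_word lam T = w"
  proof (subst w, unfold column_word_def N[symmetric], rule map_cong[OF refl])
    fix i assume "i \<in> set [1..<Suc N]"
    then have "i \<in> T ` diagram lam" using bij by (auto simp: bij_betw_def)
    then obtain r c where rc: "(r, c) \<in> diagram lam" "i = T (r, c)" by auto
    then have "i \<in> I c" using TI d by simp
    then show "tab_column lam T i = w ! (i - 1)" using tab_column_eq[OF SYT] rc by (simp add: I_def)
  qed
  then show ?thesis using SYT by blast
qed

lemma column_word_bij:
  assumes part: "is_partition lam"
  shows "bij_betw (\<lambda>T. rev (column_word lam T)) (SYT lam)
    {q. lattice_word q \<and> (\<forall>c. count_list q c = col_length lam c)}"
proof (rule bij_betw_imageI)
  show "inj_on (\<lambda>T. rev (column_word lam T)) (SYT lam)"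
    using column_word_inj[OF part] by (simp add: inj_on_def)
  have "q \<in> (\<lambda>T. rev (column_word lam T)) ` SYT lam"
    if q: "lattice_word q" "\<forall>c. count_list q c = col_length lam c" for q
  proof -
    obtain T where "T \<in> SYT lam" "column_word lam T = rev q"
      using column_word_surj[OF part, of "rev q"] q by auto
    then show ?thesis by (metis image_eqI rev_rev_ident)
  qed
  then show "(\<lambda>T. rev (column_word lam T)) ` SYT lam =
      {q. lattice_word q \<and> (\<forall>c. count_list q c = col_length lam c)}"
    using column_word_lattice[OF part] column_word_count by auto
qed

text \<open>The conjugate partition: row \<open>r\<close> has as many cells as there are columns
  longer than \<open>r\<close>.\<close>

lemma conjugate_partition:
  fixes h :: "nat \<Rightarrow> nat"
  assumes mono: "\<And>c. h (Suc c) \<le> h c" and fin: "\<And>c. l \<le> c \<Longrightarrow> h c = 0"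
  shows "\<exists>lam. is_partition lam \<and> (\<forall>c. col_length lam c = h c)"
proof -
  define A where "A = (\<lambda>r. {c. r < h c})"
  define lam where "lam = map (\<lambda>r. card (A r)) [0..<h 0]"
  have anti: "h c' \<le> h c" if "c \<le> c'" for c c'
    using lift_Suc_antimono_le[of h c c'] mono that by simp
  have finA: "finite (A r)" for r
  proof (rule finite_subset)
    show "A r \<subseteq> {..<l}" using fin by (auto simp: A_def not_le[symmetric])
  qed simp
  have A: "A r = {..<card (A r)}" for r
  proof (rule down_closed_lessThan[OF finA])
    fix a b assume "a \<in> A r" "b \<le> a"
    then show "b \<in> A r" using anti[of b a] by (simp add: A_def)
  qed
  have "card (A r') \<le> card (A r)" if "r < r'" for r r'
    using that by (intro card_mono finA) (auto simp: A_def)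
  then have "sorted_wrt (\<ge>) lam"
    by (simp add: lam_def sorted_wrt_iff_nth_less)
  moreover have "0 \<notin> set lam"
  proof
    assume "0 \<in> set lam"
    then obtain r where "r < h 0" "card (A r) = 0" by (auto simp: lam_def)
    then show False using A[of r] by (auto simp: A_def)
  qed
  moreover have "col_length lam c = h c" for c
  proof -
    have "(r, c) \<in> diagram lam \<longleftrightarrow> r < h c" for r
    proof -
      have "c < card (A r) \<longleftrightarrow> r < h c" using A[of r] by (auto simp: A_def)
      then show ?thesis using anti[of 0 c] by (auto simp: diagram_def lam_def)
    qed
    then have "{r. (r, c) \<in> diagram lam} = {..<h c}" by auto
    then show ?thesis by (simp add: col_length_def)
  qed
  ultimately show ?thesis unfolding is_partition_def by blast
qed

section \<open>Tableaux with given descent composition\<close>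

lemma count_list_concat_distinct:
  assumes "\<And>b. b \<in> set bs \<Longrightarrow> distinct b"
  shows "count_list (concat bs) c \<le> length bs"
  using assms
proof (induction bs)
  case (Cons b bs)
  have "count_list b c \<le> 1" if "distinct b" for b
    using that by (induction b) auto
  then have "count_list b c \<le> 1" using Cons.prems by simp
  then show ?case using Cons by fastforce
qed simp

text \<open>The first \<open>m\<close> letters make up at most \<open>j\<close> strictly increasing
  runs, each containing a given letter at most once.\<close>

lemma count_take_runs:
  fixes w :: "nat list"
  assumes "m = sum_list (take j (run_lengths (<) w))"
  shows "m \<le> length w" "count_list (take m w) c \<le> j"
proof -
  let ?rs = "runs_by (<) w"
  have "concat (take j ?rs) @ concat (drop j ?rs) = w"
    by (metis append_take_drop_id concat_append concat_runs_by)
  moreover have "length (concat (take j ?rs)) = m" by (simp add: assms length_concat take_map)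
  ultimately have "take m w = concat (take j ?rs)" and le: "m \<le> length w"
    by (metis append_eq_conv_conj, metis le_add1 length_append)
  moreover have "distinct b" if "b \<in> set (take j ?rs)" for b
    using runs_by_sorted[of "(<)" b w] in_set_takeD[OF that] by (simp add: strict_sorted_iff)
  ultimately show "count_list (take m w) c \<le> j"
    using count_list_concat_distinct[of "take j ?rs" c] by (simp add: min.coboundedI2)
  show "m \<le> length w" by (rule le)
qed

text \<open>The cells under an entry up to \<open>m\<close> hold smaller entries, and a column has
  at most \<open>j\<close> entries up to \<open>m\<close>.\<close>

lemma SYT_rows_of_Des:
  assumes part: "is_partition lam" and T: "T \<in> SYT lam" and m: "m = sum_list (take j (tab_Des lam T))"
  shows "m \<le> sum_list lam" "(r, c) \<in> diagram lam \<Longrightarrow> T (r, c) \<le> m \<Longrightarrow> r < j"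
proof -
  note runs = count_take_runs[OF m[unfolded tab_Des_column_word]]
  show mN: "m \<le> sum_list lam" using runs(1) by simp
  assume rc: "(r, c) \<in> diagram lam" "T (r, c) \<le> m"
  have d: "(r', c) \<in> diagram lam" if "r' \<le> r" for r'
    using diagram_down[OF part rc(1) that] by simp
  have "(\<lambda>r'. T (r', c)) ` {..r} \<subseteq> {i \<in> {1..m}. tab_column lam T i = c}"
  proof clarify
    fix r' assume r': "r' \<le> r"
    have "T (r', c) \<le> T (r, c)"
      using SYT_less_col[OF T d[OF r'] rc(1)] r' by (cases "r' = r") auto
    moreover have "T (r', c) \<in> {1..sum_list lam}"
      using T d[OF r'] by (auto simp: SYT_def bij_betw_def)
    ultimately show "T (r', c) \<in> {1..m} \<and> tab_column lam T (T (r', c)) = c"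
      using rc(2) tab_column_eq[OF T d[OF r']] by simp
  qed
  moreover have "inj_on (\<lambda>r'. T (r', c)) {..r}"
    using SYT_less_col[OF T d d] by (auto simp: inj_on_def) (metis less_irrefl linorder_neqE_nat)
  ultimately have "card {..r} \<le> card {i \<in> {1..m}. tab_column lam T i = c}"
    by (intro card_inj_on_le) auto
  also have "\<dots> \<le> j" using runs(2)[of c] count_column_word[OF mN] by simp
  finally show "r < j" by simp
qed

lemma SYT_small_entries:
  assumes T: "T \<in> SYT lam" and m: "m \<le> sum_list lam"
  shows "card {x \<in> diagram lam. T x \<le> m} = m"
proof -
  have bij: "bij_betw T (diagram lam) {1..sum_list lam}" using T by (simp add: SYT_def)
  then have "inj_on T {x \<in> diagram lam. T x \<le> m}" by (auto simp: bij_betw_def inj_on_def)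
  moreover have "T ` {x \<in> diagram lam. T x \<le> m} = {1..m}"
  proof (intro set_eqI iffI)
    fix i assume "i \<in> {1..m}"
    then have "i \<in> T ` diagram lam" using bij m by (auto simp: bij_betw_def)
    then show "i \<in> T ` {x \<in> diagram lam. T x \<le> m}" using \<open>i \<in> {1..m}\<close> by auto
  next
    fix i assume "i \<in> T ` {x \<in> diagram lam. T x \<le> m}"
    then show "i \<in> {1..m}" using bij by (auto simp: bij_betw_def)
  qed
  ultimately show ?thesis using card_image[of T "{x \<in> diagram lam. T x \<le> m}"] by simp
qed

lemma SYT_dominance:
  assumes "is_partition lam" "T \<in> SYT lam"
  shows "sum_list (take j (tab_Des lam T)) \<le> sum_list (take j lam)"
proof -
  define m where "m = sum_list (take j (tab_Des lam T))"
  note rows = SYT_rows_of_Des[OF assms m_def]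
  have "{x \<in> diagram lam. T x \<le> m} \<subseteq> {(r, c) \<in> diagram lam. r < j}" using rows(2) by auto
  then have "card {x \<in> diagram lam. T x \<le> m} \<le> card {(r, c) \<in> diagram lam. r < j}"
    by (intro card_mono finite_subset[OF _ finite_diagram]) auto
  then show ?thesis using SYT_small_entries[OF assms(2) rows(1)] by (simp add: card_diagram_rows m_def)
qed

lemma take_sums_eq:
  fixes xs ys :: "nat list"
  assumes "\<And>j. sum_list (take j xs) = sum_list (take j ys)" "0 \<notin> set xs" "0 \<notin> set ys"
  shows "xs = ys"
  using assms
proof (induction xs ys rule: list_induct2')
  case (2 x xs)
  then show ?case using 2(1)[of 1] by simp
next
  case (3 y ys)
  then show ?case using 3(1)[of 1] by simp
next
  case (4 x xs y ys)
  have xy: "x = y" using 4(2)[of 1] by simp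
  then have "sum_list (take j xs) = sum_list (take j ys)" for j using 4(2)[of "Suc j"] by simp
  then show ?case using 4 xy by simp
qed simp

text \<open>Dominance holds both ways, so all partial sums agree. This will make the shape intrinsic
  to a class.\<close>

lemma SYT_cross_Des:
  assumes "is_partition lam" "T \<in> SYT lam" "tab_Des lam T = mu"
    and "is_partition mu" "U \<in> SYT mu" "tab_Des mu U = lam"
  shows "lam = mu"
proof (rule take_sums_eq)
  fix j
  show "sum_list (take j lam) = sum_list (take j mu)"
    using SYT_dominance[OF assms(1,2), of j] SYT_dominance[OF assms(4,5), of j] assms(3,6) by simp
qed (use assms in \<open>auto simp: is_partition_def\<close>)

lemma SYT_Des_eq_shape:
  assumes part: "is_partition lam" and T: "T \<in> SYT lam" and Des: "tab_Des lam T = lam"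
    and rc: "(r, c) \<in> diagram lam"
  shows "T (r, c) = sum_list (take r lam) + c + 1"
proof -
  \<comment> \<open>The dominance bound is attained here, so the inclusion of the small entries in
    the lowest \<open>j\<close> rows is an equality.\<close>
  have rows: "{x \<in> diagram lam. T x \<le> sum_list (take j lam)} = {(r, c) \<in> diagram lam. r < j}" for j
  proof (rule card_subset_eq)
    note * = SYT_rows_of_Des[OF part T, of "sum_list (take j lam)" j, unfolded Des, OF refl]
    show "{x \<in> diagram lam. T x \<le> sum_list (take j lam)} \<subseteq> {(r, c) \<in> diagram lam. r < j}"
      using *(2) by auto
    show "card {x \<in> diagram lam. T x \<le> sum_list (take j lam)} = card {(r, c) \<in> diagram lam. r < j}"
      using SYT_small_entries[OF T *(1)] by (simp add: card_diagram_rows)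
    show "finite {(r, c) \<in> diagram lam. r < j}"
      by (rule finite_subset[OF _ finite_diagram]) auto
  qed
  define m where "m = sum_list (take r lam)"
  have r: "r < length lam" "c < lam ! r" using rc by (auto simp: diagram_def)
  then have m': "sum_list (take (Suc r) lam) = m + lam ! r"
    by (simp add: m_def take_Suc_conv_app_nth)
  have "map (\<lambda>c. T (r, c)) [0..<lam ! r] = sorted_list_of_set {Suc m..m + lam ! r}"
  proof (rule sorted_list_of_set_eqI[symmetric])
    show "sorted_wrt (<) (map (\<lambda>c. T (r, c)) [0..<lam ! r])"
      using SYT_less_row[OF T] r by (simp add: sorted_wrt_iff_nth_less diagram_def)
    have inj: "inj_on (\<lambda>c. T (r, c)) {..<lam ! r}"
      using T r by (auto simp: SYT_def bij_betw_def inj_on_def diagram_def)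
    have "(\<lambda>c. T (r, c)) ` {..<lam ! r} \<subseteq> {Suc m..m + lam ! r}"
    proof clarify
      fix c' assume "c' < lam ! r"
      then have d: "(r, c') \<in> diagram lam" using r by (simp add: diagram_def)
      then have "T (r, c') \<le> m + lam ! r" "\<not> T (r, c') \<le> m"
        using rows[of "Suc r"] rows[of r] unfolding m' m_def[symmetric] by blast+
      then show "T (r, c') \<in> {Suc m..m + lam ! r}" by simp
    qed
    then have "(\<lambda>c. T (r, c)) ` {..<lam ! r} = {Suc m..m + lam ! r}"
      by (rule card_subset_eq[rotated]) (simp_all add: card_image[OF inj])
    then show "set (map (\<lambda>c. T (r, c)) [0..<lam ! r]) = {Suc m..m + lam ! r}"
      by (simp add: atLeast0LessThan)
  qed
  also have "\<dots> = [Suc m..<Suc (m + lam ! r)]"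
    by (rule sorted_list_of_set_eqI) (auto simp del: upt_Suc)
  finally have "map (\<lambda>c. T (r, c)) [0..<lam ! r] ! c = [Suc m..<Suc (m + lam ! r)] ! c" by simp
  then show ?thesis using r by (simp add: m_def del: upt_Suc)
qed

text \<open>Column indices of consecutive entries run up from 0 along each row and restart at the
  next, so the runs are the rows.\<close>

lemma super_tableau:
  assumes part: "is_partition lam"
  shows "super_tableau lam \<in> SYT lam" "tab_Des lam (super_tableau lam) = lam"
proof -
  let ?Y = "super_tableau lam"
  have Y: "?Y \<in> SYT lam \<and> rev_reading_word lam ?Y = rev [1..<Suc (sum_list lam)]"
    unfolding super_tableau_def by (rule theI'[OF ex1_super_tableau[OF part]])
  then show SYT: "?Y \<in> SYT lam" by simp
  have "[1..<Suc (sum_list lam)] = rev (rev_reading_word lam ?Y)" using Y by simp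
  then have "column_word lam ?Y = map (tab_column lam ?Y) (rev (rev_reading_word lam ?Y))"
    by (simp add: column_word_def)
  also have "\<dots> = concat (map (\<lambda>r. map (\<lambda>c. tab_column lam ?Y (?Y (r, c))) [0..<lam ! r]) [0..<length lam])"
    unfolding rev_reading_word_rev by (simp add: map_concat o_def)
  also have "\<dots> = concat (map (\<lambda>r. [0..<lam ! r]) [0..<length lam])"
  proof (intro arg_cong[where f = concat] map_cong refl)
    fix r assume "r \<in> set [0..<length lam]"
    then have "tab_column lam ?Y (?Y (r, c)) = c" if "c < lam ! r" for c
      using that by (intro tab_column_eq[OF SYT]) (simp add: diagram_def)
    then show "map (\<lambda>c. tab_column lam ?Y (?Y (r, c))) [0..<lam ! r] = [0..<lam ! r]"
      by (auto intro!: map_idI)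
  qed
  also have "map (\<lambda>r. [0..<lam ! r]) [0..<length lam] = map (\<lambda>k. [0..<k]) lam"
    by (rule nth_equalityI) simp_all
  finally show "tab_Des lam ?Y = lam"
    using part unfolding tab_Des_column_word is_partition_def
    by (simp add: runs_by_concat_upt o_def)
qed

lemma SYT_Des_eq_shape_unique:
  assumes "is_partition lam" "T \<in> SYT lam" "tab_Des lam T = lam"
  shows "T = super_tableau lam"
proof (rule extensionalityI[of _ "diagram lam"])
  fix x assume "x \<in> diagram lam"
  then show "T x = super_tableau lam x"
    using SYT_Des_eq_shape[OF assms] SYT_Des_eq_shape[OF assms(1) super_tableau[OF assms(1)]]
    by (cases x) simp
qed (use assms super_tableau[OF assms(1)] in \<open>auto simp: SYT_def\<close>)

section \<open>The Schur expansion\<close>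

text \<open>\<open>Q_word\<close> and reversed column words are bijections onto the same lattice
  words once \<open>lam\<close> is given the column lengths of the insertion tableau.\<close>

lemma dual_class_SYT:
  assumes w: "w permutes {1..n}" and \<rho>: "\<rho> \<in> reduced_exprs n w"
  shows "\<exists>lam f. is_partition lam \<and> bij_betw f (dual_class n w \<rho>) (SYT lam) \<and>
    (\<forall>\<sigma>\<in>dual_class n w \<rho>. tab_Des lam (f \<sigma>) = word_Des \<sigma>)"
proof -
  have red: "reduced \<rho>" using reduced_exprs_reduced[OF w \<rho>] .
  let ?h = "\<lambda>c. card (line (P_tab \<rho>) c)"
  have tab: "tab (P_tab \<rho>)" using P_tab_tab[OF red] .
  have "?h c = 0" if "length (P_tab \<rho>) \<le> c" for c using tab_line_empty[OF tab, of c] that by simp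
  then obtain lam where part: "is_partition lam" and lam: "\<And>c. col_length lam c = ?h c"
    using conjugate_partition[of ?h "length (P_tab \<rho>)"] tab_line_card[OF tab] by blast
  define L where "L = {q. lattice_word q \<and> (\<forall>c. count_list q c = col_length lam c)}"
  define g where "g = (\<lambda>T. rev (column_word lam T))"
  have g: "bij_betw g (SYT lam) L"
    unfolding g_def L_def by (rule column_word_bij[OF part])
  have Q: "bij_betw Q_word (dual_class n w \<rho>) L"
    unfolding dual_class_eq[OF \<rho>] L_def lam by (rule Q_word_bij[OF red])
  define f where "f = inv_into (SYT lam) g \<circ> Q_word"
  have f: "bij_betw f (dual_class n w \<rho>) (SYT lam)"
    unfolding f_def using Q bij_betw_inv_into[OF g] by (rule bij_betw_trans)
  have "tab_Des lam (f \<sigma>) = word_Des \<sigma>" if \<sigma>: "\<sigma> \<in> dual_class n w \<rho>" for \<sigma>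
  proof -
    have "Q_word \<sigma> \<in> L" using Q \<sigma> by (auto simp: bij_betw_def)
    then have "g (f \<sigma>) = Q_word \<sigma>" using bij_betw_inv_into_right[OF g] by (simp add: f_def)
    then have "column_word lam (f \<sigma>) = rev (Q_word \<sigma>)" by (simp add: g_def rev_swap)
    moreover have "reduced \<sigma>" using \<sigma> red ck_equiv_reduced by (auto simp: dual_class_eq[OF \<rho>])
    ultimately show ?thesis by (simp add: tab_Des_column_word word_Des_Q_word)
  qed
  then show ?thesis using part f by blast
qed

lemma dual_class_cong:
  assumes "\<rho> \<in> reduced_exprs n w" "\<sigma> \<in> dual_class n w \<rho>"
  shows "\<sigma> \<in> reduced_exprs n w" "dual_class n w \<sigma> = dual_class n w \<rho>"
proof -
  show \<sigma>: "\<sigma> \<in> reduced_exprs n w" using assms(2) by (simp add: dual_class_def)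
  have "ck_equiv \<rho> \<sigma>" using assms dual_class_eq by auto
  then show "dual_class n w \<sigma> = dual_class n w \<rho>"
    unfolding dual_class_eq[OF assms(1)] dual_class_eq[OF \<sigma>]
    by (auto intro: equivclp_trans equivclp_sym)
qed

text \<open>The shape hidden in \<open>super_standard\<close> is the descent composition of its
  super-standard tableau, which the bijection carries over to \<open>\<rho>\<close>.\<close>

lemma super_standard_Des:
  assumes "super_standard n w \<rho>"
  obtains f where "is_partition (word_Des \<rho>)" "bij_betw f (dual_class n w \<rho>) (SYT (word_Des \<rho>))"
    "\<And>\<sigma>. \<sigma> \<in> dual_class n w \<rho> \<Longrightarrow> tab_Des (word_Des \<rho>) (f \<sigma>) = word_Des \<sigma>"
    "f \<rho> = super_tableau (word_Des \<rho>)"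
proof -
  obtain lam f where *: "\<rho> \<in> reduced_exprs n w" "is_partition lam"
    "bij_betw f (dual_class n w \<rho>) (SYT lam)"
    "\<forall>\<sigma>\<in>dual_class n w \<rho>. tab_Des lam (f \<sigma>) = word_Des \<sigma>" "f \<rho> = super_tableau lam"
    using assms unfolding super_standard_def by blast
  have "\<rho> \<in> dual_class n w \<rho>" using *(1) by (simp add: dual_class_def)
  then have "word_Des \<rho> = lam" using * super_tableau(2) by metis
  then show ?thesis using that[of f] * by blast
qed

lemma super_standard_exists:
  assumes w: "w permutes {1..n}" and \<rho>: "\<rho> \<in> reduced_exprs n w"
  shows "\<exists>\<sigma>\<in>dual_class n w \<rho>. super_standard n w \<sigma>"
proof -
  obtain lam f where *: "is_partition lam" "bij_betw f (dual_class n w \<rho>) (SYT lam)"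
    "\<forall>\<sigma>\<in>dual_class n w \<rho>. tab_Des lam (f \<sigma>) = word_Des \<sigma>"
    using dual_class_SYT[OF w \<rho>] by blast
  then obtain \<sigma> where \<sigma>: "\<sigma> \<in> dual_class n w \<rho>" "f \<sigma> = super_tableau lam"
    using super_tableau(1)[OF *(1)] by (metis bij_betw_imp_surj_on imageE)
  have "super_standard n w \<sigma>"
    unfolding super_standard_def using dual_class_cong[OF \<rho> \<sigma>(1)] * \<sigma>(2) by auto
  then show ?thesis using \<sigma>(1) by blast
qed

text \<open>The two elements may come with different shapes and bijections. Each bijection sends the
  other element to a tableau whose descent composition is the other shape, so the shapes agree, and
  descents then single out the tableau.\<close>

lemma super_standard_unique:
  assumes \<rho>: "super_standard n w \<rho>" and \<sigma>: "super_standard n w \<sigma>" and eq: "\<sigma> \<in> dual_class n w \<rho>"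
  shows "\<sigma> = \<rho>"
proof -
  from \<rho> obtain f where f: "is_partition (word_Des \<rho>)"
    "bij_betw f (dual_class n w \<rho>) (SYT (word_Des \<rho>))"
    "\<And>\<tau>. \<tau> \<in> dual_class n w \<rho> \<Longrightarrow> tab_Des (word_Des \<rho>) (f \<tau>) = word_Des \<tau>"
    "f \<rho> = super_tableau (word_Des \<rho>)" using super_standard_Des by blast
  from \<sigma> obtain g where g: "is_partition (word_Des \<sigma>)"
    "bij_betw g (dual_class n w \<sigma>) (SYT (word_Des \<sigma>))"
    "\<And>\<tau>. \<tau> \<in> dual_class n w \<sigma> \<Longrightarrow> tab_Des (word_Des \<sigma>) (g \<tau>) = word_Des \<tau>"
    using super_standard_Des by blast
  have R: "\<rho> \<in> reduced_exprs n w" using \<rho> by (simp add: super_standard_def)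
  then have mem: "\<rho> \<in> dual_class n w \<rho>" by (simp add: dual_class_def)
  note cls = dual_class_cong(2)[OF R eq]
  have SYT: "f \<sigma> \<in> SYT (word_Des \<rho>)" "g \<rho> \<in> SYT (word_Des \<sigma>)"
    using f(2) g(2) eq mem unfolding cls by (auto simp: bij_betw_def)
  have Des: "word_Des \<rho> = word_Des \<sigma>"
    using SYT_cross_Des[OF f(1) SYT(1) _ g(1) SYT(2)] f(3) g(3) eq mem cls by simp
  then have "f \<sigma> = super_tableau (word_Des \<rho>)"
    using SYT_Des_eq_shape_unique[OF f(1) SYT(1)] f(3)[OF eq] by simp
  then show ?thesis using f(2,4) eq mem by (auto simp: bij_betw_def inj_on_def)
qed

lemma schur_super_standard:
  assumes "super_standard n w \<rho>"
  shows "schur (word_Des \<rho>) = (\<Sum>\<sigma>\<in>dual_class n w \<rho>. fund_qsym (word_Des \<sigma>))"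
proof -
  from assms obtain f where f: "bij_betw f (dual_class n w \<rho>) (SYT (word_Des \<rho>))"
    "\<And>\<sigma>. \<sigma> \<in> dual_class n w \<rho> \<Longrightarrow> tab_Des (word_Des \<rho>) (f \<sigma>) = word_Des \<sigma>"
    using super_standard_Des by blast
  have "schur (word_Des \<rho>) =
      (\<Sum>\<sigma>\<in>dual_class n w \<rho>. fund_qsym (tab_Des (word_Des \<rho>) (f \<sigma>)))"
    unfolding schur_def by (rule sum.reindex_bij_betw[OF f(1), symmetric])
  then show ?thesis using f(2) by simp
qed

lemma sum_const_scale: "(\<Sum>x\<in>A. f) = scale (int (card A)) f"
  by (induction A rule: infinite_finite_induct) (auto simp: scale_def fun_eq_iff algebra_simps)

theorem corollary2p13:
  fixes n :: nat and w :: "nat \<Rightarrow> nat"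
  assumes "w permutes {1..n}"
  shows "stanley n w =
           (\<Sum>\<rho> | \<rho> \<in> reduced_exprs n w \<and> super_standard n w \<rho>. schur (word_Des \<rho>)) \<and>
         (\<Sum>\<rho> | \<rho> \<in> reduced_exprs n w \<and> super_standard n w \<rho>. schur (word_Des \<rho>)) =
           (\<Sum>lam | is_partition lam \<and> super_count n w lam \<noteq> 0.
              scale (int (super_count n w lam)) (schur lam))"
proof
  let ?R = "reduced_exprs n w"
  let ?S = "{\<rho>. \<rho> \<in> ?R \<and> super_standard n w \<rho>}"
  have finS: "finite ?S" by (rule finite_subset[OF _ finite_reduced_exprs]) auto
  have sub: "dual_class n w \<rho> \<subseteq> ?R" for \<rho> by (auto simp: dual_class_def)
  \<comment> \<open>With \<open>disj\<close>, the classes partition the reduced expressions and are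
    indexed by their super-standard elements.\<close>
  have union: "?R = (\<Union>\<rho>\<in>?S. dual_class n w \<rho>)"
  proof
    show "?R \<subseteq> (\<Union>\<rho>\<in>?S. dual_class n w \<rho>)"
    proof
      fix \<rho> assume \<rho>: "\<rho> \<in> ?R"
      obtain \<sigma> where \<sigma>: "\<sigma> \<in> dual_class n w \<rho>" "super_standard n w \<sigma>"
        using super_standard_exists[OF assms \<rho>] by blast
      have "\<rho> \<in> dual_class n w \<sigma>"
        using dual_class_cong(2)[OF \<rho> \<sigma>(1)] \<rho> by (simp add: dual_class_def)
      then show "\<rho> \<in> (\<Union>\<rho>\<in>?S. dual_class n w \<rho>)" using \<sigma> sub by blast
    qed
  qed (use sub in blast)
  have disj: "dual_class n w \<rho> \<inter> dual_class n w \<sigma> = {}" if "\<rho> \<in> ?S" "\<sigma> \<in> ?S" "\<rho> \<noteq> \<sigma>" for \<rho> \<sigma>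
  proof (rule ccontr)
    assume "dual_class n w \<rho> \<inter> dual_class n w \<sigma> \<noteq> {}"
    then have "dual_class n w \<rho> = dual_class n w \<sigma>" using dual_class_cong(2) that by blast
    moreover have "\<sigma> \<in> dual_class n w \<sigma>" using that by (simp add: dual_class_def)
    ultimately show False using super_standard_unique that by blast
  qed
  have "stanley n w = (\<Sum>\<rho>\<in>?S. \<Sum>\<sigma>\<in>dual_class n w \<rho>. fund_qsym (word_Des \<sigma>))"
    unfolding stanley_def by (subst union, rule sum.UNION_disjoint)
      (use finS disj finite_subset[OF sub finite_reduced_exprs] in auto)
  also have "\<dots> = (\<Sum>\<rho>\<in>?S. schur (word_Des \<rho>))"
    by (rule sum.cong) (auto dest: schur_super_standard)
  finally show "stanley n w = (\<Sum>\<rho>\<in>?S. schur (word_Des \<rho>))" .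
  let ?L = "{lam. is_partition lam \<and> super_count n w lam \<noteq> 0}"
  \<comment> \<open>Grouping by descent composition over \<open>?L\<close> thus loses no
    term.\<close>
  have "word_Des \<rho> \<in> ?L" if "\<rho> \<in> ?S" for \<rho>
  proof -
    have "is_partition (word_Des \<rho>)" using that super_standard_Des by blast
    moreover have "finite {\<sigma> \<in> ?R. super_standard n w \<sigma> \<and> word_Des \<sigma> = word_Des \<rho>}"
      using finite_reduced_exprs by simp
    then have "super_count n w (word_Des \<rho>) \<noteq> 0"
      unfolding super_count_def card_eq_0_iff using that by blast
    ultimately show ?thesis by simp
  qed
  then have "(\<Sum>\<rho>\<in>?S. schur (word_Des \<rho>)) = (\<Sum>lam\<in>?L. \<Sum>\<rho>\<in>{\<rho> \<in> ?S. word_Des \<rho> = lam}. schur (word_Des \<rho>))"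
    by (intro sum.group[symmetric] finS finite_super_support) auto
  also have "\<dots> = (\<Sum>lam\<in>?L. scale (int (super_count n w lam)) (schur lam))"
  proof (rule sum.cong[OF refl])
    fix lam
    have "(\<Sum>\<rho>\<in>{\<rho> \<in> ?S. word_Des \<rho> = lam}. schur (word_Des \<rho>)) = (\<Sum>\<rho>\<in>{\<rho> \<in> ?S. word_Des \<rho> = lam}. schur lam)"
      by (rule sum.cong) auto
    also have "\<dots> = scale (int (super_count n w lam)) (schur lam)"
      unfolding sum_const_scale super_count_def by (simp add: conj_assoc)
    finally show "(\<Sum>\<rho>\<in>{\<rho> \<in> ?S. word_Des \<rho> = lam}. schur (word_Des \<rho>)) =
        scale (int (super_count n w lam)) (schur lam)" .
  qed
  finally show "(\<Sum>\<rho>\<in>?S. schur (word_Des \<rho>)) =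
      (\<Sum>lam\<in>?L. scale (int (super_count n w lam)) (schur lam))" .
qed

end
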